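(* The Banach space $L^\infty[0,1]$ (with respect to Lebesgue measure) has a bank, that is, there exists a closed subspace $E\subset L^\infty[0,1]$ which is a bank; and every separable closed subspace of $L^\infty[0,1]$ is poor in $L^\infty[0,1]$.
   Context: Scalars are real. For a Banach space $X$, $B_X$ denotes its closed unit ball. A normed space $X$ has the Daugavet property if $\|\mathrm{Id}+T\| = 1+\|T\|$ for every rank-one bounded linear operator $T\colon X\to X$. The space $L^\infty[0,1]$ has the Daugavet property. Poor subspace: let $X$ be a Banach space with the Daugavet property. A closed subspace $Z\subset X$ is said to be poor (in $X$) if the quotient space $X/\tilde Z$ has the Daugavet property for every closed subspace $\tilde Z\subset Z$. Bank: let $X$ be a Banach space with the Daugavet property. A closed subspace $E\subset X$ is said to be a bank if $E$ contains an isomorphic copy of $\ell^1$ and, for every poor subspace $Z$ of $X$, the set $q_E(B_Z)$ is nowhere dense in $B_{X/E}$, where $q_E\colon X\to X/E$ is the natural quotient map. *)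

theory Defs
  imports "HOL-Analysis.Analysis" "HOL-Probability.Essential_Supremum"
begin

section \<open>The Banach space of essentially bounded functions on the unit interval\<close>

abbreviation leb01 :: "real measure" where
  "leb01 \<equiv> lebesgue_on {0..1}"

definition ess_bounded01 :: "(real \<Rightarrow> real) \<Rightarrow> bool" where
  "ess_bounded01 f \<longleftrightarrow>
     f \<in> borel_measurable leb01 \<and> (\<exists>C. AE x in leb01. \<bar>f x\<bar> \<le> C)"

definition ess_norm01 :: "(real \<Rightarrow> real) \<Rightarrow> real" where
  "ess_norm01 f = real_of_ereal (esssup leb01 (\<lambda>x. ereal \<bar>f x\<bar>))"

lemma ess_bounded01_I:
  "f \<in> borel_measurable leb01 \<Longrightarrow> AE x in leb01. \<bar>f x\<bar> \<le> C \<Longrightarrow> ess_bounded01 f"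
  unfolding ess_bounded01_def by blast

lemma ess_bounded01_measurable: "ess_bounded01 f \<Longrightarrow> f \<in> borel_measurable leb01"
  unfolding ess_bounded01_def by blast

lemma leb01_AE_const: "(AE x in leb01. P) \<longleftrightarrow> P"
proof -
  have "emeasure leb01 (space leb01) = 1"
    by (simp add: emeasure_restrict_space)
  then have "\<not> (AE x in leb01. False)"
    using ae_filter_eq_bot_iff[of leb01] by (simp add: trivial_limit_def)
  then show ?thesis by (cases P) auto
qed

lemma ess_norm01_aux:
  assumes "ess_bounded01 f"
  shows "ereal (ess_norm01 f) = esssup leb01 (\<lambda>x. ereal \<bar>f x\<bar>)"
proof -
  from assms have m[measurable]: "f \<in> borel_measurable leb01"
    by (rule ess_bounded01_measurable)
  from assms obtain C where "AE x in leb01. \<bar>f x\<bar> \<le> C"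
    unfolding ess_bounded01_def by blast
  then have "esssup leb01 (\<lambda>x. ereal \<bar>f x\<bar>) \<le> ereal C"
    by (intro esssup_I) auto
  moreover have "0 \<le> esssup leb01 (\<lambda>x. ereal \<bar>f x\<bar>)"
  proof -
    have "AE x in leb01. 0 \<le> esssup leb01 (\<lambda>x. ereal \<bar>f x\<bar>)"
      using esssup_AE[of "\<lambda>x. ereal \<bar>f x\<bar>" leb01]
    proof eventually_elim
      case (elim x)
      have "(0::ereal) \<le> ereal \<bar>f x\<bar>" by simp
      then show ?case using elim by (rule order_trans)
    qed
    then show ?thesis by (simp only: leb01_AE_const)
  qed
  ultimately have "\<bar>esssup leb01 (\<lambda>x. ereal \<bar>f x\<bar>)\<bar> \<noteq> \<infinity>"
    by auto
  then show ?thesis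
    unfolding ess_norm01_def by (simp add: ereal_real)
qed

lemma ess_norm01_AE:
  assumes "ess_bounded01 f"
  shows "AE x in leb01. \<bar>f x\<bar> \<le> ess_norm01 f"
  using esssup_AE[of "\<lambda>x. ereal \<bar>f x\<bar>" leb01]
  unfolding ess_norm01_aux[OF assms, symmetric] by simp

lemma ess_norm01_le:
  assumes "ess_bounded01 f" "AE x in leb01. \<bar>f x\<bar> \<le> c"
  shows "ess_norm01 f \<le> c"
proof -
  have m[measurable]: "f \<in> borel_measurable leb01"
    using assms(1) by (rule ess_bounded01_measurable)
  have "ereal (ess_norm01 f) \<le> ereal c"
    unfolding ess_norm01_aux[OF assms(1)] using assms(2) by (intro esssup_I) auto
  then show ?thesis by simp
qed

lemma ess_norm01_nonneg:
  assumes "ess_bounded01 f"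
  shows "0 \<le> ess_norm01 f"
proof -
  have "AE x in leb01. 0 \<le> ess_norm01 f"
    using ess_norm01_AE[OF assms] by eventually_elim linarith
  then show ?thesis by (simp only: leb01_AE_const)
qed

lemma ess_bounded01_add:
  assumes "ess_bounded01 f" "ess_bounded01 g"
  shows "ess_bounded01 (\<lambda>x. f x + g x)"
proof (rule ess_bounded01_I)
  show "(\<lambda>x. f x + g x) \<in> borel_measurable leb01"
    using assms[THEN ess_bounded01_measurable] by (rule borel_measurable_add)
  show "AE x in leb01. \<bar>f x + g x\<bar> \<le> ess_norm01 f + ess_norm01 g"
    using assms[THEN ess_norm01_AE] by eventually_elim linarith
qed

lemma ess_bounded01_scale:
  assumes "ess_bounded01 f"
  shows "ess_bounded01 (\<lambda>x. c * f x)"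
proof (rule ess_bounded01_I)
  have [measurable]: "f \<in> borel_measurable leb01"
    using assms by (rule ess_bounded01_measurable)
  show "(\<lambda>x. c * f x) \<in> borel_measurable leb01" by measurable
  show "AE x in leb01. \<bar>c * f x\<bar> \<le> \<bar>c\<bar> * ess_norm01 f"
    using ess_norm01_AE[OF assms] by eventually_elim (simp add: abs_mult mult_left_mono)
qed

lemma ess_bounded01_minus: "ess_bounded01 f \<Longrightarrow> ess_bounded01 (\<lambda>x. - f x)"
  using ess_bounded01_scale[of f "-1"] by simp

lemma ess_bounded01_diff:
  "ess_bounded01 f \<Longrightarrow> ess_bounded01 g \<Longrightarrow> ess_bounded01 (\<lambda>x. f x - g x)"
  using ess_bounded01_add[of f "\<lambda>x. - g x"] ess_bounded01_minus[of g] by simp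

lemma ess_bounded01_zero: "ess_bounded01 (\<lambda>x. 0)"
  by (rule ess_bounded01_I[where C = 0]) auto

lemma ess_norm01_cong:
  assumes "ess_bounded01 f" "ess_bounded01 g" "AE x in leb01. f x = g x"
  shows "ess_norm01 f = ess_norm01 g"
proof (rule antisym)
  show "ess_norm01 f \<le> ess_norm01 g"
    by (rule ess_norm01_le[OF assms(1)])
      (use ess_norm01_AE[OF assms(2)] assms(3) in eventually_elim, simp)
  show "ess_norm01 g \<le> ess_norm01 f"
    by (rule ess_norm01_le[OF assms(2)])
      (use ess_norm01_AE[OF assms(1)] assms(3) in eventually_elim, simp)
qed

definition ae_eq01 :: "(real \<Rightarrow> real) \<Rightarrow> (real \<Rightarrow> real) \<Rightarrow> bool" where
  "ae_eq01 f g \<longleftrightarrow> ess_bounded01 f \<and> ess_bounded01 g \<and> (AE x in leb01. f x = g x)"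

quotient_type linf01 = "real \<Rightarrow> real" / partial: ae_eq01
proof (rule part_equivpI)
  show "\<exists>f. ae_eq01 f f"
    using ess_bounded01_zero unfolding ae_eq01_def by auto
  show "symp ae_eq01"
    unfolding ae_eq01_def by (auto intro!: sympI elim: eventually_mono)
  show "transp ae_eq01"
  proof (rule transpI)
    fix f g h assume *: "ae_eq01 f g" "ae_eq01 g h"
    then have "AE x in leb01. f x = g x" "AE x in leb01. g x = h x"
      unfolding ae_eq01_def by auto
    then have "AE x in leb01. f x = h x" by eventually_elim simp
    with * show "ae_eq01 f h" unfolding ae_eq01_def by auto
  qed
qed

instantiation linf01 :: real_normed_vector
begin

lift_definition zero_linf01 :: linf01 is "\<lambda>x. 0"
  by (simp add: ae_eq01_def ess_bounded01_zero)

lift_definition plus_linf01 :: "linf01 \<Rightarrow> linf01 \<Rightarrow> linf01" is "\<lambda>f g x. f x + g x"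
  by (auto simp: ae_eq01_def intro: ess_bounded01_add)

lift_definition minus_linf01 :: "linf01 \<Rightarrow> linf01 \<Rightarrow> linf01" is "\<lambda>f g x. f x - g x"
  by (auto simp: ae_eq01_def intro: ess_bounded01_diff)

lift_definition uminus_linf01 :: "linf01 \<Rightarrow> linf01" is "\<lambda>f x. - f x"
  by (auto simp: ae_eq01_def intro: ess_bounded01_minus)

lift_definition scaleR_linf01 :: "real \<Rightarrow> linf01 \<Rightarrow> linf01" is "\<lambda>c f x. c * f x"
  by (auto simp: ae_eq01_def intro: ess_bounded01_scale)

lift_definition norm_linf01 :: "linf01 \<Rightarrow> real" is ess_norm01
  by (auto simp: ae_eq01_def intro: ess_norm01_cong)

definition dist_linf01 :: "linf01 \<Rightarrow> linf01 \<Rightarrow> real" where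
  "dist_linf01 f g = norm (f - g)"

definition sgn_linf01 :: "linf01 \<Rightarrow> linf01" where
  "sgn_linf01 f = inverse (norm f) *\<^sub>R f"

definition uniformity_linf01 :: "(linf01 \<times> linf01) filter" where
  "uniformity_linf01 = (INF e\<in>{0 <..}. principal {(x, y). dist x y < e})"

definition open_linf01 :: "linf01 set \<Rightarrow> bool" where
  "open_linf01 U = (\<forall>x\<in>U. eventually (\<lambda>(x', y). x' = x \<longrightarrow> y \<in> U) uniformity)"

instance
proof
  fix f g h :: linf01 and a b :: real
  show "f + g + h = f + (g + h)"
    by transfer (auto simp: ae_eq01_def add.assoc intro!: ess_bounded01_add)
  show "f + g = g + f"
    by transfer (auto simp: ae_eq01_def add.commute intro!: ess_bounded01_add)
  show "0 + f = f"
    by transfer (auto simp: ae_eq01_def)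
  show "- f + f = 0"
    by transfer (auto simp: ae_eq01_def ess_bounded01_zero)
  show "f - g = f + - g"
    by transfer (auto simp: ae_eq01_def intro!: ess_bounded01_diff)
  show "a *\<^sub>R (f + g) = a *\<^sub>R f + a *\<^sub>R g"
    by transfer (auto simp: ae_eq01_def distrib_left
        intro!: ess_bounded01_add ess_bounded01_scale)
  show "(a + b) *\<^sub>R f = a *\<^sub>R f + b *\<^sub>R f"
    by transfer (auto simp: ae_eq01_def distrib_right
        intro!: ess_bounded01_add ess_bounded01_scale)
  show "a *\<^sub>R b *\<^sub>R f = (a * b) *\<^sub>R f"
    by transfer (auto simp: ae_eq01_def mult.assoc intro!: ess_bounded01_scale)
  show "1 *\<^sub>R f = f"
    by transfer (auto simp: ae_eq01_def)
  show "dist f g = norm (f - g)"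
    by (fact dist_linf01_def)
  show "sgn f = inverse (norm f) *\<^sub>R f"
    by (fact sgn_linf01_def)
  show "uniformity = (INF e\<in>{0 <..}. principal {(x, y). dist (x::linf01) y < e})"
    by (fact uniformity_linf01_def)
  show "open U = (\<forall>x\<in>U. \<forall>\<^sub>F (x', y) in uniformity. x' = x \<longrightarrow> y \<in> U)" for U :: "linf01 set"
    by (fact open_linf01_def)
  show "norm f = 0 \<longleftrightarrow> f = 0"
  proof (transfer, rule iffI)
    fix f assume "ae_eq01 f f"
    then have f: "ess_bounded01 f" by (simp add: ae_eq01_def)
    { assume "ess_norm01 f = 0"
      then have "AE x in leb01. f x = 0"
        using ess_norm01_AE[OF f] by simp
      then show "ae_eq01 f (\<lambda>x. 0)"
        using f ess_bounded01_zero by (simp add: ae_eq01_def) }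
    { assume "ae_eq01 f (\<lambda>x. 0)"
      then have "AE x in leb01. \<bar>f x\<bar> \<le> 0" by (simp add: ae_eq01_def)
      then show "ess_norm01 f = 0"
        using ess_norm01_le[OF f] ess_norm01_nonneg[OF f] by fastforce }
  qed
  show "norm (f + g) \<le> norm f + norm g"
  proof transfer
    fix f g assume "ae_eq01 f f" "ae_eq01 g g"
    then have fg: "ess_bounded01 f" "ess_bounded01 g" by (simp_all add: ae_eq01_def)
    have "AE x in leb01. \<bar>f x + g x\<bar> \<le> ess_norm01 f + ess_norm01 g"
      using fg[THEN ess_norm01_AE] by eventually_elim linarith
    then show "ess_norm01 (\<lambda>x. f x + g x) \<le> ess_norm01 f + ess_norm01 g"
      by (rule ess_norm01_le[OF ess_bounded01_add[OF fg]])
  qed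
  show "norm (a *\<^sub>R f) = \<bar>a\<bar> * norm f"
  proof transfer
    fix a :: real and f assume "ae_eq01 f f"
    then have f: "ess_bounded01 f" by (simp add: ae_eq01_def)
    have le: "ess_norm01 (\<lambda>x. c * g x) \<le> \<bar>c\<bar> * ess_norm01 g"
      if g: "ess_bounded01 g" for c g
    proof (rule ess_norm01_le[OF ess_bounded01_scale[OF g]])
      show "AE x in leb01. \<bar>c * g x\<bar> \<le> \<bar>c\<bar> * ess_norm01 g"
        using ess_norm01_AE[OF g] by eventually_elim (simp add: abs_mult mult_left_mono)
    qed
    show "ess_norm01 (\<lambda>x. a * f x) = \<bar>a\<bar> * ess_norm01 f"
    proof (cases "a = 0")
      case True
      then show ?thesis
        using le[OF f, of a] ess_norm01_nonneg[OF ess_bounded01_scale[OF f, of a]] by simp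
    next
      case False
      have "ess_norm01 (\<lambda>x. inverse a * (a * f x)) \<le> \<bar>inverse a\<bar> * ess_norm01 (\<lambda>x. a * f x)"
        by (rule le[OF ess_bounded01_scale[OF f]])
      moreover have "(\<lambda>x. inverse a * (a * f x)) = f"
        using False by auto
      ultimately have "\<bar>a\<bar> * ess_norm01 f \<le> ess_norm01 (\<lambda>x. a * f x)"
        using False by (simp add: field_simps abs_inverse)
      with le[OF f, of a] show ?thesis by simp
    qed
  qed
qed

end

instance linf01 :: banach
proof
  fix X :: "nat \<Rightarrow> linf01"
  assume X: "Cauchy X"
  define f where "f n = rep_linf01 (X n)" for n
  have ff: "ae_eq01 (f n) (f n)" and Xf: "X n = abs_linf01 (f n)" for n
    using Quotient_rep_reflp[OF Quotient_linf01, of "X n"]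
      Quotient_abs_rep[OF Quotient_linf01, of "X n"] by (simp_all add: f_def)
  have f: "ess_bounded01 (f n)" for n
    using ff[of n] by (simp add: ae_eq01_def)
  have norm_abs: "norm (abs_linf01 g) = ess_norm01 g" if "ess_bounded01 g" for g
    using that by (intro norm_linf01.abs_eq) (simp add: ae_eq01_def)
  have minus_abs: "abs_linf01 g - abs_linf01 h = abs_linf01 (\<lambda>x. g x - h x)"
    if "ess_bounded01 g" "ess_bounded01 h" for g h
    using that by (intro minus_linf01.abs_eq) (simp_all add: ae_eq01_def)
  have nX: "norm (X m - X n) = ess_norm01 (\<lambda>x. f m x - f n x)" for m n
    unfolding Xf by (simp add: minus_abs norm_abs f ess_bounded01_diff)
  have ae: "AE x in leb01. \<forall>m n. \<bar>f m x - f n x\<bar> \<le> norm (X m - X n)"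
    unfolding nX AE_all_countable using ess_norm01_AE ess_bounded01_diff f by blast
  define F where "F x = lim (\<lambda>n. f n x)" for x
  have Fm: "F \<in> borel_measurable leb01"
    unfolding F_def by (intro borel_measurable_lim_metric ess_bounded01_measurable f)
  have aeF: "AE x in leb01. (\<lambda>n. f n x) \<longlonglongrightarrow> F x"
    using ae
  proof eventually_elim
    case (elim x)
    have "Cauchy (\<lambda>n. f n x)"
    proof (rule metric_CauchyI)
      fix e :: real assume "e > 0"
      then obtain N where "\<And>m n. m \<ge> N \<Longrightarrow> n \<ge> N \<Longrightarrow> dist (X m) (X n) < e"
        using X unfolding Cauchy_def by blast
      then show "\<exists>M. \<forall>m\<ge>M. \<forall>n\<ge>M. dist (f m x) (f n x) < e"
        using elim unfolding dist_norm real_norm_def by (meson le_less_trans)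
    qed
    then show ?case
      unfolding F_def by (simp add: Cauchy_convergent_iff convergent_LIMSEQ_iff)
  qed
  have close: "AE x in leb01. \<bar>f n x - F x\<bar> \<le> e"
    if "\<And>m. m \<ge> N \<Longrightarrow> dist (X n) (X m) < e" for n N e
    using ae aeF
  proof eventually_elim
    case (elim x)
    have "(\<lambda>m. \<bar>f n x - f m x\<bar>) \<longlonglongrightarrow> \<bar>f n x - F x\<bar>"
      by (intro tendsto_intros elim)
    moreover have "\<bar>f n x - f m x\<bar> \<le> e" if "m \<ge> N" for m
      using elim(1) \<open>\<And>m. m \<ge> N \<Longrightarrow> dist (X n) (X m) < e\<close>[OF that]
      by (metis dist_norm less_imp_le order_trans)
    ultimately show ?case
      by (intro LIMSEQ_le_const2[of _ "\<bar>f n x - F x\<bar>" e]) auto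
  qed
  have Fb: "ess_bounded01 F"
  proof -
    obtain N where "\<And>m n. m \<ge> N \<Longrightarrow> n \<ge> N \<Longrightarrow> dist (X m) (X n) < 1"
      using X unfolding Cauchy_def by (meson zero_less_one)
    then have "AE x in leb01. \<bar>f N x - F x\<bar> \<le> 1"
      by (intro close[of N]) auto
    then have "AE x in leb01. \<bar>F x\<bar> \<le> ess_norm01 (f N) + 1"
      using ess_norm01_AE[OF f[of N]] by eventually_elim linarith
    with Fm show ?thesis by (rule ess_bounded01_I)
  qed
  have "X \<longlonglongrightarrow> abs_linf01 F"
  proof (rule metric_LIMSEQ_I)
    fix e :: real assume e: "e > 0"
    then obtain N where N: "\<And>m n. m \<ge> N \<Longrightarrow> n \<ge> N \<Longrightarrow> dist (X m) (X n) < e / 2"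
      using X unfolding Cauchy_def by (meson half_gt_zero)
    have "dist (X n) (abs_linf01 F) < e" if "n \<ge> N" for n
    proof -
      have "dist (X n) (abs_linf01 F) = ess_norm01 (\<lambda>x. f n x - F x)"
        unfolding dist_norm Xf by (simp add: minus_abs norm_abs f Fb ess_bounded01_diff)
      also have "\<dots> \<le> e / 2"
        by (intro ess_norm01_le ess_bounded01_diff f Fb close[of N]) (use N that in auto)
      finally show ?thesis using e by linarith
    qed
    then show "\<exists>N. \<forall>n\<ge>N. dist (X n) (abs_linf01 F) < e" by blast
  qed
  then show "convergent X" by (rule convergentI)
qed


section \<open>Normed spaces with an explicit carrier\<close>

text \<open>
  Quotients \<open>X / Z\<close> by a varying subspace \<open>Z\<close> are not types, so notions that are applied to
  quotients are formulated for real normed spaces given by a carrier set and operations.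
\<close>

record 'a nspace =
  ncarrier :: "'a set"
  nadd :: "'a \<Rightarrow> 'a \<Rightarrow> 'a"
  nscale :: "real \<Rightarrow> 'a \<Rightarrow> 'a"
  nzero :: "'a"
  nnorm :: "'a \<Rightarrow> real"

locale normed_nspace =
  fixes X :: "'a nspace"
  assumes add_closed: "x \<in> ncarrier X \<Longrightarrow> y \<in> ncarrier X \<Longrightarrow> nadd X x y \<in> ncarrier X"
    and scale_closed: "x \<in> ncarrier X \<Longrightarrow> nscale X c x \<in> ncarrier X"
    and zero_closed: "nzero X \<in> ncarrier X"
    and add_assoc: "x \<in> ncarrier X \<Longrightarrow> y \<in> ncarrier X \<Longrightarrow> z \<in> ncarrier X \<Longrightarrow>
      nadd X (nadd X x y) z = nadd X x (nadd X y z)"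
    and add_commute: "x \<in> ncarrier X \<Longrightarrow> y \<in> ncarrier X \<Longrightarrow> nadd X x y = nadd X y x"
    and add_zero: "x \<in> ncarrier X \<Longrightarrow> nadd X (nzero X) x = x"
    and add_inverse: "x \<in> ncarrier X \<Longrightarrow> nadd X (nscale X (-1) x) x = nzero X"
    and scale_add_right: "x \<in> ncarrier X \<Longrightarrow> y \<in> ncarrier X \<Longrightarrow>
      nscale X c (nadd X x y) = nadd X (nscale X c x) (nscale X c y)"
    and scale_add_left: "x \<in> ncarrier X \<Longrightarrow>
      nscale X (c + d) x = nadd X (nscale X c x) (nscale X d x)"
    and scale_scale: "x \<in> ncarrier X \<Longrightarrow> nscale X c (nscale X d x) = nscale X (c * d) x"
    and scale_one: "x \<in> ncarrier X \<Longrightarrow> nscale X 1 x = x"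
    and norm_eq_zero: "x \<in> ncarrier X \<Longrightarrow> nnorm X x = 0 \<longleftrightarrow> x = nzero X"
    and norm_triangle: "x \<in> ncarrier X \<Longrightarrow> y \<in> ncarrier X \<Longrightarrow>
      nnorm X (nadd X x y) \<le> nnorm X x + nnorm X y"
    and norm_scale: "x \<in> ncarrier X \<Longrightarrow> nnorm X (nscale X c x) = \<bar>c\<bar> * nnorm X x"

definition nball :: "'a nspace \<Rightarrow> 'a set" where
  "nball X = {x \<in> ncarrier X. nnorm X x \<le> 1}"

text \<open>The value off the carrier only serves the global symmetry demanded by \<open>Metric_space\<close>.\<close>

definition ndist :: "'a nspace \<Rightarrow> 'a \<Rightarrow> 'a \<Rightarrow> real" where
  "ndist X x y =
     (if x \<in> ncarrier X \<and> y \<in> ncarrier X then nnorm X (nadd X x (nscale X (-1) y)) else 0)"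

definition ntopology :: "'a nspace \<Rightarrow> 'a topology" where
  "ntopology X = Metric_space.mtopology (ncarrier X) (ndist X)"

definition nspace_bounded_linear :: "'a nspace \<Rightarrow> 'b nspace \<Rightarrow> ('a \<Rightarrow> 'b) \<Rightarrow> bool" where
  "nspace_bounded_linear X Y T \<longleftrightarrow>
     (\<forall>x\<in>ncarrier X. T x \<in> ncarrier Y) \<and>
     (\<forall>x\<in>ncarrier X. \<forall>y\<in>ncarrier X. T (nadd X x y) = nadd Y (T x) (T y)) \<and>
     (\<forall>c. \<forall>x\<in>ncarrier X. T (nscale X c x) = nscale Y c (T x)) \<and>
     (\<exists>K. \<forall>x\<in>ncarrier X. nnorm Y (T x) \<le> K * nnorm X x)"

definition nspace_onorm :: "'a nspace \<Rightarrow> 'b nspace \<Rightarrow> ('a \<Rightarrow> 'b) \<Rightarrow> real" where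
  "nspace_onorm X Y T = (SUP x\<in>nball X. nnorm Y (T x))"

definition rank_one :: "'a nspace \<Rightarrow> 'b nspace \<Rightarrow> ('a \<Rightarrow> 'b) \<Rightarrow> bool" where
  "rank_one X Y T \<longleftrightarrow>
     (\<exists>y\<in>ncarrier Y. y \<noteq> nzero Y \<and> T ` ncarrier X = {nscale Y c y |c. True})"

definition daugavet_property :: "'a nspace \<Rightarrow> bool" where
  "daugavet_property X \<longleftrightarrow>
     (\<forall>T. nspace_bounded_linear X X T \<and> rank_one X X T \<longrightarrow>
        nspace_onorm X X (\<lambda>x. nadd X x (T x)) = 1 + nspace_onorm X X T)"

definition nspace_isomorphism :: "'a nspace \<Rightarrow> 'b nspace \<Rightarrow> ('a \<Rightarrow> 'b) \<Rightarrow> bool" where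
  "nspace_isomorphism X Y T \<longleftrightarrow>
     nspace_bounded_linear X Y T \<and>
     bij_betw T (ncarrier X) (ncarrier Y) \<and>
     nspace_bounded_linear Y X (inv_into (ncarrier X) T)"

definition nowhere_dense_in :: "'a topology \<Rightarrow> 'a set \<Rightarrow> bool" where
  "nowhere_dense_in \<tau> A \<longleftrightarrow> A \<subseteq> topspace \<tau> \<and> \<tau> interior_of (\<tau> closure_of A) = {}"

definition nspace_of :: "'a::real_normed_vector set \<Rightarrow> 'a nspace" where
  "nspace_of S = \<lparr>ncarrier = S, nadd = (+), nscale = (*\<^sub>R), nzero = 0, nnorm = norm\<rparr>"

definition ell1 :: "(nat \<Rightarrow> real) nspace" where
  "ell1 = \<lparr>ncarrier = {a. summable (\<lambda>n. \<bar>a n\<bar>)},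
     nadd = (\<lambda>a b n. a n + b n), nscale = (\<lambda>c a n. c * a n), nzero = (\<lambda>n. 0),
     nnorm = (\<lambda>a. \<Sum>n. \<bar>a n\<bar>)\<rparr>"

definition quot_map :: "'a::real_normed_vector set \<Rightarrow> 'a \<Rightarrow> 'a set" where
  "quot_map Z x = {x + z |z. z \<in> Z}"

text \<open>Adding \<open>z\<close> in the scalar multiplication makes \<open>0\<close> times a coset equal to \<open>Z\<close>.\<close>

definition quot_space :: "'a::real_normed_vector set \<Rightarrow> 'a set nspace" where
  "quot_space Z =
     \<lparr>ncarrier = range (quot_map Z),
      nadd = (\<lambda>A B. {a + b |a b. a \<in> A \<and> b \<in> B}),
      nscale = (\<lambda>c A. {c *\<^sub>R a + z |a z. a \<in> A \<and> z \<in> Z}),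
      nzero = Z,
      nnorm = (\<lambda>A. INF a\<in>A. norm a)\<rparr>"

lemma (in normed_nspace) scale_zero: "x \<in> ncarrier X \<Longrightarrow> nscale X 0 x = nzero X"
  using scale_add_left[of x "-1" 1] scale_one[of x] add_inverse[of x] by simp

lemma (in normed_nspace) norm_nonneg: "x \<in> ncarrier X \<Longrightarrow> 0 \<le> nnorm X x"
  using norm_triangle[of "nscale X (-1) x" x] norm_scale[of x "-1"] scale_closed[of x "-1"]
    add_inverse[of x] norm_eq_zero[OF zero_closed] by simp

lemma (in normed_nspace) norm_minus_commute:
  assumes "x \<in> ncarrier X" "y \<in> ncarrier X"
  shows "nnorm X (nadd X x (nscale X (-1) y)) = nnorm X (nadd X y (nscale X (-1) x))"
proof -
  have "nscale X (-1) (nadd X x (nscale X (-1) y)) = nadd X y (nscale X (-1) x)"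
    using assms by (simp add: scale_add_right scale_scale scale_one scale_closed add_commute)
  then show ?thesis
    using norm_scale[of "nadd X x (nscale X (-1) y)" "-1"] assms
    by (simp add: add_closed scale_closed)
qed

lemma (in normed_nspace) diff_add_diff:
  assumes "x \<in> ncarrier X" "y \<in> ncarrier X" "z \<in> ncarrier X"
  shows "nadd X (nadd X x (nscale X (-1) y)) (nadd X y (nscale X (-1) z)) =
    nadd X x (nscale X (-1) z)"
proof -
  have "nadd X (nadd X x (nscale X (-1) y)) (nadd X y (nscale X (-1) z)) =
    nadd X x (nadd X (nadd X (nscale X (-1) y) y) (nscale X (-1) z))"
    using assms by (simp add: add_assoc add_closed scale_closed)
  then show ?thesis
    using assms by (simp add: add_inverse add_zero scale_closed)
qed

lemma (in normed_nspace) diff_eq_zero: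
  assumes "x \<in> ncarrier X" "y \<in> ncarrier X"
  shows "nadd X x (nscale X (-1) y) = nzero X \<longleftrightarrow> x = y"
proof
  assume "nadd X x (nscale X (-1) y) = nzero X"
  then have "nadd X (nzero X) y = nadd X (nadd X x (nscale X (-1) y)) y" by simp
  also have "\<dots> = nadd X x (nzero X)"
    using assms by (simp add: add_assoc scale_closed add_inverse)
  finally show "x = y"
    using assms by (simp add: add_zero add_commute[of x] zero_closed)
next
  assume "x = y"
  then show "nadd X x (nscale X (-1) y) = nzero X"
    using assms add_inverse[of y] add_commute[of y "nscale X (-1) y"] by (simp add: scale_closed)
qed

lemma (in normed_nspace) Metric_space_ndist: "Metric_space (ncarrier X) (ndist X)"
proof
  fix x y z
  show "0 \<le> ndist X x y"
    by (simp add: ndist_def norm_nonneg add_closed scale_closed)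
  show "ndist X x y = ndist X y x"
    by (simp add: ndist_def norm_minus_commute)
  show "x \<in> ncarrier X \<Longrightarrow> y \<in> ncarrier X \<Longrightarrow> ndist X x y = 0 \<longleftrightarrow> x = y"
    by (simp add: ndist_def norm_eq_zero add_closed scale_closed diff_eq_zero)
  assume "x \<in> ncarrier X" "y \<in> ncarrier X" "z \<in> ncarrier X"
  then show "ndist X x z \<le> ndist X x y + ndist X y z"
    using norm_triangle[of "nadd X x (nscale X (-1) y)" "nadd X y (nscale X (-1) z)"]
    by (simp add: ndist_def diff_add_diff add_closed scale_closed)
qed

lemma normed_nspace_of: "subspace S \<Longrightarrow> normed_nspace (nspace_of S)"
  by unfold_locales
    (auto simp: nspace_of_def subspace_add subspace_scale subspace_0 algebra_simps norm_triangle_ineq)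

lemma normed_nspace_ell1: "normed_nspace ell1"
proof
  fix a b :: "nat \<Rightarrow> real"
  assume "a \<in> ncarrier ell1" "b \<in> ncarrier ell1"
  then have ab: "summable (\<lambda>n. \<bar>a n\<bar>)" "summable (\<lambda>n. \<bar>b n\<bar>)" by (simp_all add: ell1_def)
  then have s: "summable (\<lambda>n. \<bar>a n\<bar> + \<bar>b n\<bar>)" by (rule summable_add)
  have s': "summable (\<lambda>n. \<bar>a n + b n\<bar>)"
    by (rule summable_comparison_test'[OF s, of 0]) auto
  then show "nadd ell1 a b \<in> ncarrier ell1" by (simp add: ell1_def)
  show "nnorm ell1 (nadd ell1 a b) \<le> nnorm ell1 a + nnorm ell1 b"
    using suminf_le[OF _ s' s] suminf_add[OF ab] by (simp add: ell1_def abs_triangle_ineq)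
next
  fix a :: "nat \<Rightarrow> real" and c :: real
  assume "a \<in> ncarrier ell1"
  then have a: "summable (\<lambda>n. \<bar>a n\<bar>)" by (simp add: ell1_def)
  then show "nscale ell1 c a \<in> ncarrier ell1"
    by (simp add: ell1_def abs_mult summable_mult)
  show "nnorm ell1 (nscale ell1 c a) = \<bar>c\<bar> * nnorm ell1 a"
    using a by (simp add: ell1_def abs_mult suminf_mult)
  show "nnorm ell1 a = 0 \<longleftrightarrow> a = nzero ell1"
    using a by (auto simp: ell1_def suminf_eq_zero_iff)
qed (auto simp: ell1_def algebra_simps)

context
  fixes Z :: "'a::real_normed_vector set"
  assumes Z: "subspace Z"
begin

lemma quot_map_eq_iff: "quot_map Z x = quot_map Z y \<longleftrightarrow> x - y \<in> Z"
proof
  assume "quot_map Z x = quot_map Z y"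
  moreover have "x \<in> quot_map Z x"
    using subspace_0[OF Z] by (force simp: quot_map_def)
  ultimately show "x - y \<in> Z" by (auto simp: quot_map_def)
next
  assume *: "x - y \<in> Z"
  have "x + z = y + ((x - y) + z)" "y + z = x + (z - (x - y))" for z by simp_all
  then show "quot_map Z x = quot_map Z y"
    unfolding quot_map_def using * subspace_add[OF Z] subspace_diff[OF Z]
    by (auto; blast)
qed

lemma quot_add: "nadd (quot_space Z) (quot_map Z x) (quot_map Z y) = quot_map Z (x + y)"
proof -
  have "x + y + z = (x + z) + (y + 0)" "(x + z) + (y + w) = x + y + (z + w)" for z w
    by (simp_all add: algebra_simps)
  then show ?thesis
    unfolding quot_space_def quot_map_def using subspace_0[OF Z] subspace_add[OF Z]
    by (auto; metis)
qed

lemma quot_scale: "nscale (quot_space Z) c (quot_map Z x) = quot_map Z (c *\<^sub>R x)"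
proof -
  have "c *\<^sub>R x + z = c *\<^sub>R (x + 0) + z" "c *\<^sub>R (x + z) + w = c *\<^sub>R x + (c *\<^sub>R z + w)" for z w
    by (simp_all add: algebra_simps)
  then show ?thesis
    unfolding quot_space_def quot_map_def
    using subspace_0[OF Z] subspace_add[OF Z] subspace_scale[OF Z]
    by (auto; metis)
qed

lemma quot_zero: "nzero (quot_space Z) = quot_map Z 0"
  by (auto simp: quot_space_def quot_map_def)

lemma quot_norm: "nnorm (quot_space Z) (quot_map Z x) = infdist x Z"
proof -
  have ne: "Z \<noteq> {}" using subspace_0[OF Z] by auto
  have "norm ` quot_map Z x = dist x ` Z"
  proof (intro set_eqI iffI)
    fix r assume "r \<in> norm ` quot_map Z x"
    then obtain z where "z \<in> Z" "r = norm (x + z)" by (auto simp: quot_map_def)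
    then show "r \<in> dist x ` Z"
      using subspace_neg[OF Z] by (intro image_eqI[of _ _ "- z"]) (auto simp: dist_norm)
  next
    fix r assume "r \<in> dist x ` Z"
    then obtain z where "z \<in> Z" "r = norm (x - z)" by (auto simp: dist_norm)
    then show "r \<in> norm ` quot_map Z x"
      using subspace_neg[OF Z] unfolding quot_map_def
      by (intro image_eqI[of _ _ "x + (- z)"]) auto
  qed
  then show ?thesis using ne by (simp add: quot_space_def infdist_def)
qed

lemma normed_nspace_quot:
  assumes "closed Z"
  shows "normed_nspace (quot_space Z)"
proof -
  have car: "ncarrier (quot_space Z) = range (quot_map Z)" by (simp add: quot_space_def)
  have ne: "Z \<noteq> {}" using subspace_0[OF Z] by auto
  have attained: "\<exists>z\<in>Z. dist x z < infdist x Z + d" if "d > 0" for x d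
  proof (rule ccontr)
    assume "\<not> (\<exists>z\<in>Z. dist x z < infdist x Z + d)"
    then have "infdist x Z + d \<le> infdist x Z"
      unfolding infdist_notempty[OF ne] by (intro cINF_greatest ne) (simp add: not_less)
    with that show False by simp
  qed
  have tri: "infdist (x + y) Z \<le> infdist x Z + infdist y Z" for x y
  proof (rule field_le_epsilon)
    fix e :: real assume e: "e > 0"
    obtain z w where zw: "z \<in> Z" "dist x z < infdist x Z + e / 2"
        "w \<in> Z" "dist y w < infdist y Z + e / 2"
      using attained[of "e / 2"] e by (meson half_gt_zero)
    have "infdist (x + y) Z \<le> dist (x + y) (z + w)"
      by (intro infdist_le subspace_add[OF Z] zw)
    also have "\<dots> \<le> dist x z + dist y w" by (rule dist_triangle_add)
    finally show "infdist (x + y) Z \<le> infdist x Z + infdist y Z + e" using zw by simp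
  qed
  have sc_le: "infdist (c *\<^sub>R x) Z \<le> \<bar>c\<bar> * infdist x Z" if "c \<noteq> 0" for c x
  proof (rule field_le_epsilon)
    fix e :: real assume "e > 0"
    then obtain z where z: "z \<in> Z" "dist x z < infdist x Z + e / \<bar>c\<bar>"
      using attained[of "e / \<bar>c\<bar>" x] \<open>c \<noteq> 0\<close> by auto
    have "infdist (c *\<^sub>R x) Z \<le> dist (c *\<^sub>R x) (c *\<^sub>R z)"
      by (intro infdist_le subspace_scale[OF Z] z)
    also have "\<dots> = \<bar>c\<bar> * dist x z"
      by (simp add: dist_norm flip: scaleR_diff_right)
    also have "\<dots> \<le> \<bar>c\<bar> * (infdist x Z + e / \<bar>c\<bar>)" using z by (intro mult_left_mono) auto
    also have "\<dots> = \<bar>c\<bar> * infdist x Z + e" using that by (simp add: field_simps)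
    finally show "infdist (c *\<^sub>R x) Z \<le> \<bar>c\<bar> * infdist x Z + e" .
  qed
  have sc: "infdist (c *\<^sub>R x) Z = \<bar>c\<bar> * infdist x Z" for c x
  proof (cases "c = 0")
    case True
    then show ?thesis using subspace_0[OF Z] by simp
  next
    case False
    then have "infdist x Z \<le> \<bar>inverse c\<bar> * infdist (c *\<^sub>R x) Z"
      using sc_le[of "inverse c" "c *\<^sub>R x"] by simp
    then have "\<bar>c\<bar> * infdist x Z \<le> infdist (c *\<^sub>R x) Z"
      using False by (simp add: field_simps abs_inverse)
    with sc_le[OF False] show ?thesis by (intro antisym)
  qed
  have z0: "infdist x Z = 0 \<longleftrightarrow> x \<in> Z" for x
    using in_closed_iff_infdist_zero[OF assms ne] by blast
  show ?thesis
    by (unfold_locales; (unfold car)?; (elim rangeE)?)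
      (simp_all add: car rangeI quot_add quot_scale quot_zero quot_norm quot_map_eq_iff tri sc z0
        algebra_simps subspace_0[OF Z])
qed

end


section \<open>Poor subspaces and banks\<close>

definition poor :: "'a::banach set \<Rightarrow> bool" where
  "poor Z \<longleftrightarrow>
     daugavet_property (nspace_of (UNIV :: 'a set)) \<and>
     subspace Z \<and> closed Z \<and>
     (\<forall>Y. subspace Y \<and> closed Y \<and> Y \<subseteq> Z \<longrightarrow> daugavet_property (quot_space Y))"

definition contains_ell1 :: "'a::real_normed_vector set \<Rightarrow> bool" where
  "contains_ell1 E \<longleftrightarrow>
     (\<exists>Y T. subspace Y \<and> Y \<subseteq> E \<and> nspace_isomorphism ell1 (nspace_of Y) T)"

definition bank :: "'a::banach set \<Rightarrow> bool" where
  "bank E \<longleftrightarrow>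
     daugavet_property (nspace_of (UNIV :: 'a set)) \<and>
     subspace E \<and> closed E \<and>
     contains_ell1 E \<and>
     (\<forall>Z. poor Z \<longrightarrow>
        nowhere_dense_in (subtopology (ntopology (quot_space E)) (nball (quot_space E)))
          (quot_map E ` {z \<in> Z. norm z \<le> 1}))"

end

theory Submission
  imports Defs "HOL-Library.Nat_Bijection"
begin

text \<open>
  The quotient of \<open>X = L\<^sup>\<infinity>[0,1]\<close> by \<open>Y\<close> has the Daugavet property as soon as, for every
  bounded functional \<open>\<phi>\<close> vanishing on \<open>Y\<close>, every \<open>f\<close> and every \<open>v\<close> in the unit ball, some \<open>g\<close> in the unit
  ball satisfies \<open>\<phi> g \<approx> \<phi> v\<close> and \<open>dist (f + g, Y) \<approx> dist (f, Y) + 1\<close> (\<open>daugavet_propertyI\<close>).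

  Let \<open>Y\<close> be separable. For each member \<open>y n\<close> of a dense sequence, \<open>\<bar>f - y n\<bar>\<close> almost reaches
  \<open>dist (f, Y)\<close> on a set of positive measure. These sets contain disjoint sets of positive measure,
  on which \<open>v\<close> can be overwritten by the sign of \<open>f - y n\<close>. There are infinitely many disjoint
  systems of such sets, and a bounded functional has to be small on the change made along one of them
  (\<open>modify_on_small_set\<close>). Subspaces of separable spaces are covered by the same argument, so
  separable subspaces are poor (\<open>separable_imp_poor\<close>).

  A bank is given by the functions \<open>E\<close> that vanish on the upper half \<open>[1/2,1]\<close>. It contains
  \<open>\<ell>\<^sup>1\<close>, spanned by functions of Rademacher type on the lower half. If the image of the unit
  ball of \<open>Z\<close> in \<open>X / E\<close> is not nowhere dense, then by convexity and symmetry \<open>Z\<close> approximates, with a uniform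
  bound, every small function on the upper half (\<open>ball_image_somewhere_dense\<close>). Such a \<open>Z\<close> is not
  poor: already the quotient by the kernel in \<open>Z\<close> of the average over the upper half fails the Daugavet
  property, as elements of this kernel can trim functions at the few places where they are too large
  (\<open>not_poor_if_restriction_dense\<close>).
\<close>

section \<open>The Daugavet property through functionals\<close>

definition nspace_functional :: "'a nspace \<Rightarrow> ('a \<Rightarrow> real) \<Rightarrow> bool" where
  "nspace_functional X \<phi> \<longleftrightarrow>
     (\<forall>x\<in>ncarrier X. \<forall>y\<in>ncarrier X. \<phi> (nadd X x y) = \<phi> x + \<phi> y) \<and>
     (\<forall>c. \<forall>x\<in>ncarrier X. \<phi> (nscale X c x) = c * \<phi> x) \<and>
     (\<exists>K. \<forall>x\<in>ncarrier X. \<bar>\<phi> x\<bar> \<le> K * nnorm X x)"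

context normed_nspace
begin

lemma zero_in_nball: "nzero X \<in> nball X"
  using zero_closed norm_eq_zero[OF zero_closed] by (simp add: nball_def)

lemma scale_minus_in_nball: "x \<in> nball X \<Longrightarrow> nscale X (-1) x \<in> nball X"
  by (simp add: nball_def scale_closed norm_scale)

lemma scale_inject:
  assumes "y \<in> ncarrier X" "y \<noteq> nzero X" "nscale X c y = nscale X d y"
  shows "c = d"
proof -
  have "nscale X (c - d) y = nadd X (nscale X c y) (nscale X (- d) y)"
    using scale_add_left[OF assms(1), of c "- d"] by simp
  also have "nscale X (- d) y = nscale X (-1) (nscale X d y)"
    using assms(1) by (simp add: scale_scale)
  also have "nadd X (nscale X c y) \<dots> = nzero X"
    using assms by (simp add: diff_eq_zero scale_closed)
  finally have "\<bar>c - d\<bar> * nnorm X y = 0"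
    using assms(1) norm_scale norm_eq_zero zero_closed by metis
  then show ?thesis using assms norm_eq_zero by auto
qed

lemma norm_triangle_lower:
  assumes "x \<in> ncarrier X" "y \<in> ncarrier X"
  shows "nnorm X x - nnorm X y \<le> nnorm X (nadd X x y)"
proof -
  have "x = nadd X (nadd X x y) (nscale X (-1) y)"
    using assms diff_eq_zero[of y y] add_zero[of x] add_commute[of x "nzero X"]
    by (simp add: add_assoc scale_closed zero_closed)
  then have "nnorm X x \<le> nnorm X (nadd X x y) + nnorm X (nscale X (-1) y)"
    using norm_triangle[of "nadd X x y" "nscale X (-1) y"] assms
    by (simp add: add_closed scale_closed)
  then show ?thesis using assms by (simp add: norm_scale)
qed

lemma bounded_linear_bdd_above:
  assumes "nspace_bounded_linear X X T"
  shows "bdd_above ((\<lambda>x. nnorm X (T x)) ` nball X)"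
    and "bdd_above ((\<lambda>x. nnorm X (nadd X x (T x))) ` nball X)"
proof -
  obtain K where K: "\<And>x. x \<in> ncarrier X \<Longrightarrow> nnorm X (T x) \<le> K * nnorm X x"
    and Tc: "\<And>x. x \<in> ncarrier X \<Longrightarrow> T x \<in> ncarrier X"
    using assms unfolding nspace_bounded_linear_def by blast
  have b: "nnorm X (T x) \<le> \<bar>K\<bar>" if "x \<in> nball X" for x
  proof -
    have "nnorm X (T x) \<le> K * nnorm X x" using that K by (simp add: nball_def)
    also have "\<dots> \<le> \<bar>K\<bar> * 1"
      using that by (intro mult_mono) (auto simp: nball_def norm_nonneg)
    finally show ?thesis by simp
  qed
  then show "bdd_above ((\<lambda>x. nnorm X (T x)) ` nball X)" by (rule bdd_aboveI2)
  have "nnorm X (nadd X x (T x)) \<le> 1 + \<bar>K\<bar>" if "x \<in> nball X" for x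
    using norm_triangle[of x "T x"] b[OF that] Tc[of x] that by (simp add: nball_def)
  then show "bdd_above ((\<lambda>x. nnorm X (nadd X x (T x))) ` nball X)" by (rule bdd_aboveI2)
qed

text \<open>
  A rank-one operator is \<open>T x = \<phi> x \<cdot> y\<close> for a bounded functional \<open>\<phi>\<close>. If \<open>g\<close> in the unit ball almost
  maximises \<open>\<phi>\<close> and almost attains the maximal distance from \<open>- u\<close>, where \<open>u\<close> is the multiple of \<open>y\<close>
  of norm \<open>\<parallel>T\<parallel>\<close>, then \<open>T g\<close> is close to \<open>u\<close> and hence \<open>g + T g\<close> has norm close to \<open>1 + \<parallel>T\<parallel>\<close>. The starting
  point \<open>v\<close> allows one to prescribe a near-maximiser of \<open>\<phi>\<close> that only has to be perturbed.
\<close>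

lemma daugavet_propertyI:
  assumes "\<And>\<phi> u v \<epsilon>. nspace_functional X \<phi> \<Longrightarrow> u \<in> ncarrier X \<Longrightarrow> v \<in> nball X \<Longrightarrow> \<epsilon> > 0 \<Longrightarrow>
     \<exists>g\<in>nball X. \<phi> v - \<epsilon> \<le> \<phi> g \<and> nnorm X u + 1 - \<epsilon> \<le> nnorm X (nadd X u g)"
  shows "daugavet_property X"
  unfolding daugavet_property_def
proof (intro allI impI, elim conjE)
  fix T assume T: "nspace_bounded_linear X X T" and r1: "rank_one X X T"
  from r1 obtain y where y: "y \<in> ncarrier X" "y \<noteq> nzero X"
    and im: "T ` ncarrier X = {nscale X c y |c. True}"
    unfolding rank_one_def by blast
  have y0: "nnorm X y > 0"
    using y norm_nonneg[of y] norm_eq_zero[of y] by linarith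
  obtain K where K: "\<And>x. x \<in> ncarrier X \<Longrightarrow> nnorm X (T x) \<le> K * nnorm X x"
    and Tc: "\<And>x. x \<in> ncarrier X \<Longrightarrow> T x \<in> ncarrier X"
    and Tadd: "\<And>x z. x \<in> ncarrier X \<Longrightarrow> z \<in> ncarrier X \<Longrightarrow> T (nadd X x z) = nadd X (T x) (T z)"
    and Tsc: "\<And>c x. x \<in> ncarrier X \<Longrightarrow> T (nscale X c x) = nscale X c (T x)"
    using T unfolding nspace_bounded_linear_def by blast
  define \<phi> where "\<phi> x = (SOME c. T x = nscale X c y)" for x
  have T\<phi>: "T x = nscale X (\<phi> x) y" if "x \<in> ncarrier X" for x
  proof -
    have "\<exists>c. T x = nscale X c y" using im that by blast
    then show ?thesis unfolding \<phi>_def by (rule someI_ex)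
  qed
  have T\<phi>n: "nnorm X (T x) = \<bar>\<phi> x\<bar> * nnorm X y" if "x \<in> ncarrier X" for x
    using T\<phi>[OF that] y by (simp add: norm_scale)
  have \<phi>sc: "\<phi> (nscale X c x) = c * \<phi> x" if "x \<in> ncarrier X" for c x
  proof (rule scale_inject[OF y])
    show "nscale X (\<phi> (nscale X c x)) y = nscale X (c * \<phi> x) y"
      using that y Tsc[OF that, of c] by (simp add: T\<phi> scale_closed scale_scale)
  qed
  have func: "nspace_functional X \<phi>"
    unfolding nspace_functional_def
  proof (intro conjI ballI allI)
    fix x z assume xz: "x \<in> ncarrier X" "z \<in> ncarrier X"
    show "\<phi> (nadd X x z) = \<phi> x + \<phi> z"
    proof (rule scale_inject[OF y])
      show "nscale X (\<phi> (nadd X x z)) y = nscale X (\<phi> x + \<phi> z) y"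
        using xz y Tadd[OF xz] by (simp add: T\<phi> add_closed scale_add_left)
    qed
  next
    show "\<exists>K. \<forall>x\<in>ncarrier X. \<bar>\<phi> x\<bar> \<le> K * nnorm X x"
    proof (intro exI ballI)
      fix x assume x: "x \<in> ncarrier X"
      show "\<bar>\<phi> x\<bar> \<le> (K / nnorm X y) * nnorm X x"
        using K[OF x] T\<phi>n[OF x] y0 by (simp add: field_simps)
    qed
  qed (fact \<phi>sc)
  define S where "S = nspace_onorm X X T"
  note bdd = bounded_linear_bdd_above[OF T]
  have TS: "nnorm X (T x) \<le> S" if "x \<in> nball X" for x
    unfolding S_def nspace_onorm_def using bdd(1) that by (rule cSUP_upper2) simp
  have ne: "nball X \<noteq> {}" using zero_in_nball by blast
  show "nspace_onorm X X (\<lambda>x. nadd X x (T x)) = 1 + nspace_onorm X X T"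
    unfolding S_def[symmetric]
  proof (rule antisym)
    show "nspace_onorm X X (\<lambda>x. nadd X x (T x)) \<le> 1 + S"
      unfolding nspace_onorm_def
    proof (rule cSUP_least[OF ne])
      fix x assume x: "x \<in> nball X"
      then show "nnorm X (nadd X x (T x)) \<le> 1 + S"
        using norm_triangle[of x "T x"] TS[OF x] Tc[of x] by (simp add: nball_def)
    qed
    show "1 + S \<le> nspace_onorm X X (\<lambda>x. nadd X x (T x))"
    proof (rule field_le_epsilon)
      fix e :: real assume e: "e > 0"
      define \<epsilon> where "\<epsilon> = e / (2 + nnorm X y)"
      have \<epsilon>: "\<epsilon> > 0" using e y0 by (simp add: \<epsilon>_def)
      have "(2 + nnorm X y) * \<epsilon> = e" using y0 by (simp add: \<epsilon>_def)
      then have e_eq: "2 * \<epsilon> + \<epsilon> * nnorm X y = e" by (simp add: algebra_simps)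
      have "S - \<epsilon> < S" using \<epsilon> by simp
      then obtain v' where v': "v' \<in> nball X" "S - \<epsilon> < nnorm X (T v')"
        unfolding S_def nspace_onorm_def using less_cSUP_iff[OF ne bdd(1)] by blast
      obtain v where v: "v \<in> nball X" "S - \<epsilon> < \<phi> v * nnorm X y"
      proof (cases "\<phi> v' \<ge> 0")
        case True
        then show ?thesis using that[of v'] v' T\<phi>n[of v'] by (simp add: nball_def)
      next
        case False
        then show ?thesis
          using that[of "nscale X (-1) v'"] v' T\<phi>n[of v'] \<phi>sc[of v' "-1"]
          by (simp add: scale_minus_in_nball) (simp add: nball_def)
      qed
      define s where "s = S / nnorm X y"
      have S: "S = s * nnorm X y" using y0 by (simp add: s_def)
      have S0: "0 \<le> S"
        using TS[OF zero_in_nball] norm_nonneg[OF Tc[OF zero_closed]] by linarith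
      then have s0: "0 \<le> s" using y0 by (simp add: s_def)
      obtain g where g: "g \<in> nball X" "\<phi> v - \<epsilon> \<le> \<phi> g"
        and ug: "nnorm X (nscale X s y) + 1 - \<epsilon> \<le> nnorm X (nadd X (nscale X s y) g)"
        using assms[OF func scale_closed[OF y(1)] v(1) \<epsilon>] by blast
      have gc: "g \<in> ncarrier X" using g by (simp add: nball_def)
      have split: "nadd X g (T g) = nadd X (nadd X (nscale X s y) g) (nscale X (\<phi> g - s) y)"
      proof -
        have "T g = nadd X (nscale X s y) (nscale X (\<phi> g - s) y)"
          using T\<phi>[OF gc] scale_add_left[OF y(1), of s "\<phi> g - s"] by simp
        then show ?thesis
          using gc y add_commute[OF gc scale_closed[OF y(1), of s]]
          by (simp add: add_assoc[symmetric] scale_closed)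
      qed
      have "\<phi> g * nnorm X y \<le> s * nnorm X y"
        using TS[OF g(1)] T\<phi>n[OF gc] mult_right_mono[OF abs_ge_self[of "\<phi> g"], of "nnorm X y"] y0
        unfolding S by linarith
      then have gs: "\<phi> g \<le> s" using y0 by simp
      have "S - \<epsilon> - \<epsilon> * nnorm X y \<le> (\<phi> v - \<epsilon>) * nnorm X y"
        using v(2) by (simp add: algebra_simps)
      also have "\<dots> \<le> \<phi> g * nnorm X y" using g(2) y0 by simp
      finally have "\<bar>\<phi> g - s\<bar> * nnorm X y \<le> \<epsilon> + \<epsilon> * nnorm X y"
        using gs S by (simp add: algebra_simps)
      moreover have "nnorm X (nscale X s y) = S"
        using s0 y S by (simp add: norm_scale)
      ultimately have "S + 1 - e \<le> nnorm X (nadd X g (T g))"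
        unfolding split using ug e_eq
          norm_triangle_lower[of "nadd X (nscale X s y) g" "nscale X (\<phi> g - s) y"] y gc
        by (simp add: norm_scale add_closed scale_closed)
      also have "\<dots> \<le> nspace_onorm X X (\<lambda>x. nadd X x (T x))"
        unfolding nspace_onorm_def using bdd(2) g(1) by (rule cSUP_upper2) simp
      finally show "1 + S \<le> nspace_onorm X X (\<lambda>x. nadd X x (T x)) + e" by simp
    qed
  qed
qed

text \<open>
  The Daugavet equation for the operator \<open>x \<mapsto> - \<phi> x \<cdot> u\<close>, which has norm 1 when \<open>u\<close> is a norming vector
  for the norm-one functional \<open>\<phi>\<close>.
\<close>

lemma daugavet_propertyD:
  assumes D: "daugavet_property X" and \<phi>: "nspace_functional X \<phi>"
    and \<phi>1: "\<And>x. x \<in> ncarrier X \<Longrightarrow> \<bar>\<phi> x\<bar> \<le> nnorm X x"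
    and u: "u \<in> ncarrier X" "nnorm X u = 1" "\<phi> u = 1" and \<epsilon>: "\<epsilon> > 0"
  obtains g where "g \<in> nball X" "2 - \<epsilon> < nnorm X (nadd X g (nscale X (- \<phi> g) u))"
proof -
  define T where "T x = nscale X (- \<phi> x) u" for x
  have nT: "nnorm X (T x) = \<bar>\<phi> x\<bar>" if "x \<in> ncarrier X" for x
    using u by (simp add: T_def norm_scale)
  have T: "nspace_bounded_linear X X T"
    unfolding nspace_bounded_linear_def
  proof (intro conjI)
    show "\<exists>K. \<forall>x\<in>ncarrier X. nnorm X (T x) \<le> K * nnorm X x"
      using \<phi>1 nT by (intro exI[of _ 1]) auto
  qed (use \<phi> u in \<open>auto simp: nspace_functional_def T_def scale_closed scale_scale
        scale_add_left[symmetric]\<close>)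
  have "rank_one X X T"
    unfolding rank_one_def
  proof (intro bexI conjI)
    show "u \<noteq> nzero X" using u norm_eq_zero[OF zero_closed] by auto
    show "T ` ncarrier X = {nscale X c u |c. True}"
    proof (intro set_eqI iffI)
      fix z assume "z \<in> {nscale X c u |c. True}"
      then obtain c where "z = nscale X c u" by blast
      then have "z = T (nscale X (- c) u)"
        using \<phi> u by (simp add: T_def nspace_functional_def)
      then show "z \<in> T ` ncarrier X" using u by (simp add: scale_closed)
    qed (auto simp: T_def)
  qed (fact u)
  then have eq: "nspace_onorm X X (\<lambda>x. nadd X x (T x)) = 1 + nspace_onorm X X T"
    using D T unfolding daugavet_property_def by blast
  note bdd = bounded_linear_bdd_above[OF T]
  have "u \<in> nball X" using u by (simp add: nball_def)
  then have "1 \<le> nspace_onorm X X T"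
    unfolding nspace_onorm_def using bdd(1) nT[OF u(1)] u(3) by (intro cSUP_upper2[of _ _ u]) auto
  then have "2 - \<epsilon> < nspace_onorm X X (\<lambda>x. nadd X x (T x))" using eq \<epsilon> by linarith
  then obtain g where "g \<in> nball X" "2 - \<epsilon> < nnorm X (nadd X g (T g))"
    unfolding nspace_onorm_def using less_cSUP_iff[OF _ bdd(2)] zero_in_nball by blast
  then show ?thesis using that unfolding T_def by blast
qed

end

section \<open>Essentially bounded functions and disjoint sets of positive measure\<close>

interpretation leb01: finite_measure leb01
  by (rule finite_measureI) (simp add: emeasure_restrict_space)

lemma rep_linf01_self: "ae_eq01 (rep_linf01 f) (rep_linf01 f)"
  by (rule Quotient_rep_reflp[OF Quotient_linf01])

lemma abs_rep_linf01: "abs_linf01 (rep_linf01 f) = f"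
  by (rule Quotient_abs_rep[OF Quotient_linf01])

lemma rep_ess_bounded01: "ess_bounded01 (rep_linf01 f)"
  using rep_linf01_self[of f] by (simp add: ae_eq01_def)

lemma rep_measurable [measurable]: "rep_linf01 f \<in> borel_measurable leb01"
  by (rule ess_bounded01_measurable[OF rep_ess_bounded01])

lemma rep_abs_AE:
  assumes "ess_bounded01 g"
  shows "AE x in leb01. rep_linf01 (abs_linf01 g) x = g x"
  using Quotient_rep_abs[OF Quotient_linf01, of g] assms by (simp add: ae_eq01_def)

lemma rep_add_AE: "AE x in leb01. rep_linf01 (f + g) x = rep_linf01 f x + rep_linf01 g x"
proof -
  have "f + g = abs_linf01 (\<lambda>x. rep_linf01 f x + rep_linf01 g x)"
    using plus_linf01.abs_eq[OF rep_linf01_self rep_linf01_self, of f g]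
    by (simp add: abs_rep_linf01)
  then show ?thesis
    using rep_abs_AE[OF ess_bounded01_add[OF rep_ess_bounded01 rep_ess_bounded01], of f g] by simp
qed

lemma rep_diff_AE: "AE x in leb01. rep_linf01 (f - g) x = rep_linf01 f x - rep_linf01 g x"
proof -
  have "f - g = abs_linf01 (\<lambda>x. rep_linf01 f x - rep_linf01 g x)"
    using minus_linf01.abs_eq[OF rep_linf01_self rep_linf01_self, of f g]
    by (simp add: abs_rep_linf01)
  then show ?thesis
    using rep_abs_AE[OF ess_bounded01_diff[OF rep_ess_bounded01 rep_ess_bounded01], of f g] by simp
qed

lemma rep_scale_AE: "AE x in leb01. rep_linf01 (c *\<^sub>R f) x = c * rep_linf01 f x"
proof -
  have "c *\<^sub>R f = abs_linf01 (\<lambda>x. c * rep_linf01 f x)"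
    using scaleR_linf01.abs_eq[OF rep_linf01_self, of c f]
    by (simp add: abs_rep_linf01)
  then show ?thesis
    using rep_abs_AE[OF ess_bounded01_scale[OF rep_ess_bounded01], of c f] by simp
qed

lemma rep_zero_AE: "AE x in leb01. rep_linf01 0 x = 0"
  using rep_scale_AE[of 0 0] by simp

lemma rep_sum_AE:
  assumes "finite I"
  shows "AE x in leb01. rep_linf01 (\<Sum>i\<in>I. f i) x = (\<Sum>i\<in>I. rep_linf01 (f i) x)"
  using assms
proof induction
  case empty
  then show ?case using rep_zero_AE by simp
next
  case (insert i I)
  show ?case
    using insert.IH rep_add_AE[of "f i" "sum f I"] by eventually_elim (use insert in simp)
qed

lemma norm_rep: "norm f = ess_norm01 (rep_linf01 f)"
  using norm_linf01.abs_eq[OF rep_linf01_self, of f] by (simp add: abs_rep_linf01)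

lemma norm_AE: "AE x in leb01. \<bar>rep_linf01 f x\<bar> \<le> norm f"
  unfolding norm_rep by (rule ess_norm01_AE[OF rep_ess_bounded01])

lemma norm_leI: "AE x in leb01. \<bar>rep_linf01 f x\<bar> \<le> c \<Longrightarrow> norm f \<le> c"
  unfolding norm_rep by (rule ess_norm01_le[OF rep_ess_bounded01])

lemma eq_AE: "AE x in leb01. rep_linf01 f x = rep_linf01 g x \<Longrightarrow> f = g"
proof -
  assume *: "AE x in leb01. rep_linf01 f x = rep_linf01 g x"
  have "norm (f - g) \<le> 0"
    by (rule norm_leI) (use * rep_diff_AE[of f g] in eventually_elim, simp)
  then show "f = g" by simp
qed

lemma norm_geI:
  assumes "B \<in> sets leb01" "measure leb01 B > 0"
    and "AE x in leb01. x \<in> B \<longrightarrow> c \<le> \<bar>rep_linf01 f x\<bar>"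
  shows "c \<le> norm f"
proof (rule ccontr)
  assume "\<not> c \<le> norm f"
  then have "AE x in leb01. x \<notin> B"
    by (intro eventually_mono[OF eventually_conj[OF assms(3) norm_AE[of f]]]) auto
  then have "emeasure leb01 B = 0"
    using sets.sets_into_space[OF assms(1)] by (subst (asm) AE_iff_measurable[OF assms(1)]) auto
  then show False using assms(2) by (simp add: measure_def)
qed

lemma measure_gt_norm_pos:
  assumes "c < norm f"
  shows "measure leb01 {x \<in> space leb01. c < \<bar>rep_linf01 f x\<bar>} > 0"
proof (rule ccontr)
  assume "\<not> ?thesis"
  then have 0: "measure leb01 {x \<in> space leb01. c < \<bar>rep_linf01 f x\<bar>} = 0"
    using measure_nonneg[of leb01] by (metis less_eq_real_def)
  have "{x \<in> space leb01. c < \<bar>rep_linf01 f x\<bar>} \<in> sets leb01" by measurable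
  then have "AE x in leb01. \<not> c < \<bar>rep_linf01 f x\<bar>"
    using 0 by (subst AE_iff_measurable[OF _ refl]) (simp_all add: leb01.emeasure_eq_measure)
  then have "norm f \<le> c" by (intro norm_leI) (simp add: not_less)
  then show False using assms by simp
qed

text \<open>
  Meaningful for measurable \<open>U\<close> only; otherwise the product need not have a class.
\<close>

definition restr01 :: "real set \<Rightarrow> linf01 \<Rightarrow> linf01" where
  "restr01 U f = abs_linf01 (\<lambda>x. indicator U x * rep_linf01 f x)"

lemma rep_restr_AE:
  assumes [measurable]: "U \<in> sets leb01"
  shows "AE x in leb01. rep_linf01 (restr01 U f) x = indicator U x * rep_linf01 f x"
  unfolding restr01_def
proof (rule rep_abs_AE, rule ess_bounded01_I)
  show "(\<lambda>x. indicator U x * rep_linf01 f x) \<in> borel_measurable leb01" by measurable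
  show "AE x in leb01. \<bar>indicator U x * rep_linf01 f x\<bar> \<le> norm f"
    using norm_AE[of f] by eventually_elim (auto simp: indicator_def)
qed

lemma bounded_linear_restr01:
  assumes U: "U \<in> sets leb01"
  shows "bounded_linear (restr01 U)"
proof (rule bounded_linear_intro[where K = 1])
  fix f g :: linf01 and c :: real
  show "restr01 U (f + g) = restr01 U f + restr01 U g"
    by (rule eq_AE)
      (use rep_restr_AE[OF U, of f] rep_restr_AE[OF U, of g] rep_restr_AE[OF U, of "f + g"]
        rep_add_AE[of f g] rep_add_AE[of "restr01 U f" "restr01 U g"]
        in eventually_elim, simp add: algebra_simps)
  show "restr01 U (c *\<^sub>R f) = c *\<^sub>R restr01 U f"
    by (rule eq_AE)
      (use rep_restr_AE[OF U, of f] rep_restr_AE[OF U, of "c *\<^sub>R f"]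
        rep_scale_AE[of c f] rep_scale_AE[of c "restr01 U f"]
        in eventually_elim, simp)
  show "norm (restr01 U f) \<le> norm f * 1"
    by (rule norm_leI)
      (use rep_restr_AE[OF U, of f] norm_AE[of f] in eventually_elim, auto simp: indicator_def)
qed

text \<open>
  Signed sums of the pieces \<open>restr01 (U k) p\<close> have norm at most \<open>\<parallel>p\<parallel>\<close> because the sets are disjoint, so the
  sum of the values \<open>\<bar>\<phi> (restr01 (U k) p)\<bar>\<close> over any finitely many \<open>k\<close> is at most \<open>\<parallel>\<phi>\<parallel> \<parallel>p\<parallel>\<close>. This replaces a
  representation of \<open>\<phi>\<close> as a finitely additive measure.
\<close>

lemma exists_small_restriction:
  assumes \<phi>: "bounded_linear (\<phi> :: linf01 \<Rightarrow> real)"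
    and U: "\<And>k::nat. U k \<in> sets leb01" and disj: "disjoint_family U" and e: "e > 0"
  shows "\<exists>k. \<bar>\<phi> (restr01 (U k) p)\<bar> \<le> e"
proof (rule ccontr)
  assume "\<not> ?thesis"
  then have big: "e < \<bar>\<phi> (restr01 (U k) p)\<bar>" for k by (simp add: not_le)
  obtain K where K: "K > 0" "\<And>x. \<bar>\<phi> x\<bar> \<le> norm x * K"
    using bounded_linear.pos_bounded[OF \<phi>] by auto
  obtain N :: nat where N: "norm p * K < real N * e"
    using reals_Archimedean3[OF e] by blast
  define \<sigma> where "\<sigma> k = sgn (\<phi> (restr01 (U k) p))" for k
  define q where "q = (\<Sum>k<N. \<sigma> k *\<^sub>R restr01 (U k) p)"
  have "AE x in leb01. \<forall>k. rep_linf01 (restr01 (U k) p) x = indicator (U k) x * rep_linf01 p x"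
    unfolding AE_all_countable using rep_restr_AE[OF U] by blast
  moreover have "AE x in leb01. \<forall>k. rep_linf01 (\<sigma> k *\<^sub>R restr01 (U k) p) x =
      \<sigma> k * rep_linf01 (restr01 (U k) p) x"
    unfolding AE_all_countable using rep_scale_AE by blast
  ultimately have "AE x in leb01. \<bar>rep_linf01 q x\<bar> \<le> norm p"
    using norm_AE[of p] rep_sum_AE[OF finite_lessThan[of N], of "\<lambda>k. \<sigma> k *\<^sub>R restr01 (U k) p"]
  proof (eventually_elim, goal_cases)
    case (1 x)
    have "\<bar>rep_linf01 q x\<bar> \<le> (\<Sum>k<N. \<bar>\<sigma> k * (indicator (U k) x * rep_linf01 p x)\<bar>)"
      using 1 by (simp add: q_def sum_abs)
    also have "\<dots> \<le> (\<Sum>k<N. indicator (U k) x * \<bar>rep_linf01 p x\<bar>)"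
      by (rule sum_mono) (auto simp: \<sigma>_def sgn_real_def indicator_def)
    also have "\<dots> = indicator (\<Union>k<N. U k) x * \<bar>rep_linf01 p x\<bar>"
      using disjoint_family_on_mono[OF _ disj, of "{..<N}"]
      by (subst indicator_UN_disjoint) (simp_all add: sum_distrib_right)
    also have "\<dots> \<le> norm p" using 1 by (auto simp: indicator_def)
    finally show ?case .
  qed
  then have q: "norm q \<le> norm p" by (rule norm_leI)
  have "real N * e \<le> (\<Sum>k<N. \<bar>\<phi> (restr01 (U k) p)\<bar>)"
    using sum_bounded_below[of "{..<N}" e "\<lambda>k. \<bar>\<phi> (restr01 (U k) p)\<bar>"] big
    by (simp add: less_imp_le)
  also have "\<dots> = \<phi> q"
    using \<phi> unfolding q_def
    by (simp add: bounded_linear.linear linear_sum linear_scale \<sigma>_def abs_sgn mult.commute)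
  also have "\<dots> \<le> norm q * K" using K(2)[of q] by simp
  also have "\<dots> \<le> norm p * K" using q K by simp
  finally show False using N by simp
qed

text \<open>
  Lebesgue measure has no atoms: among the countably many pieces cut out by a grid of width \<open>e\<close>, at
  least one is not a null set.
\<close>

lemma exists_small_subset:
  assumes A: "A \<in> sets leb01" "measure leb01 A > 0" and e: "e > 0"
  obtains B where "B \<in> sets leb01" "B \<subseteq> A" "0 < measure leb01 B" "measure leb01 B \<le> e"
proof -
  define J where "J i = {of_int i * e..(of_int i + 1) * e}" for i :: int
  have J: "J i \<inter> A \<in> sets leb01" for i
    using A by (auto simp: J_def sets_restrict_space_iff)
  have A01: "A \<subseteq> {0..1}" "A \<in> sets lebesgue"
    using A by (auto simp: sets_restrict_space_iff)
  have le: "measure leb01 (J i \<inter> A) \<le> e" for i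
  proof -
    have "measure leb01 (J i \<inter> A) = measure lebesgue (J i \<inter> A)"
      using A01 by (intro measure_restrict_space) auto
    also have "\<dots> \<le> measure lebesgue (J i)"
      using A01 by (intro measure_mono_fmeasurable) (auto simp: J_def)
    also have "\<dots> = e" using e by (simp add: J_def algebra_simps)
    finally show ?thesis .
  qed
  have "\<exists>i. measure leb01 (J i \<inter> A) > 0"
  proof (rule ccontr)
    assume "\<not> ?thesis"
    then have "measure leb01 (J i \<inter> A) = 0" for i
      using measure_nonneg[of leb01 "J i \<inter> A"] by (metis less_eq_real_def)
    then have "J i \<inter> A \<in> null_sets leb01" for i
      using J by (simp add: null_sets_def leb01.emeasure_eq_measure)
    then have "(\<Union>i. J i \<inter> A) \<in> null_sets leb01" by blast
    moreover have "(\<Union>i. J i \<inter> A) = A"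
    proof -
      have "x \<in> J \<lfloor>x / e\<rfloor>" for x
        using e floor_divide_lower[of e x] floor_divide_upper[of e x] by (auto simp: J_def)
      then show ?thesis by blast
    qed
    ultimately show False using A(2) by (simp add: null_sets_def measure_def)
  qed
  then show ?thesis using that J le by blast
qed

text \<open>
  Shrink the sets to \<open>C n\<close> so fast that the later ones together cover at most half of \<open>C n\<close>; removing
  them makes the remainders disjoint and leaves positive measure.
\<close>

lemma disjoint_positive_subsets:
  assumes A: "\<And>n::nat. A n \<in> sets leb01" "\<And>n. measure leb01 (A n) > 0"
  obtains B where "\<And>n. B n \<in> sets leb01" "\<And>n. B n \<subseteq> A n" "\<And>n. measure leb01 (B n) > 0"
    "disjoint_family B"
proof -
  let ?P = "\<lambda>n C. C \<in> sets leb01 \<and> C \<subseteq> A n \<and> 0 < measure leb01 C"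
  let ?Q = "\<lambda>n C C'. measure leb01 C' \<le> measure leb01 C / 3"
  obtain C where C: "\<And>n. ?P n (C n)" and C3: "\<And>n. ?Q n (C n) (C (Suc n))"
  proof (rule dependent_nat_choice[of ?P ?Q, THEN exE])
    show "\<exists>C. ?P 0 C" using A by blast
    show "\<exists>C'. ?P (Suc n) C' \<and> ?Q n C C'" if "?P n C" for n C
      using exists_small_subset[OF A, of "measure leb01 C / 3" "Suc n"] that
      by (metis divide_pos_pos zero_less_numeral)
  qed blast
  have C[measurable]: "C n \<in> sets leb01" and CA: "C n \<subseteq> A n" and Cpos: "0 < measure leb01 (C n)" for n
    using C by auto
  have dec: "measure leb01 (C (Suc n + j)) \<le> measure leb01 (C n) / 3 * (1/3)^j" for n j
  proof (induction j)
    case (Suc j)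
    then show ?case using C3[of "Suc n + j"] by simp
  qed (use C3 in simp)
  define D where "D n = (\<Union>j. C (Suc n + j))" for n
  define B where "B n = C n - D n" for n
  have D[measurable]: "D n \<in> sets leb01" for n unfolding D_def by measurable
  have Dle: "measure leb01 (D n) \<le> measure leb01 (C n) / 2" for n
  proof -
    have g: "(\<lambda>j. measure leb01 (C n) / 3 * (1/3)^j) sums (measure leb01 (C n) / 2)"
      using sums_mult[OF geometric_sums[of "1/3::real"], of "measure leb01 (C n) / 3"] by simp
    have s: "summable (\<lambda>j. measure leb01 (C (Suc n + j)))"
      by (rule summable_comparison_test'[OF sums_summable[OF g], of 0]) (use dec in auto)
    have "measure leb01 (D n) \<le> (\<Sum>j. measure leb01 (C (Suc n + j)))"
      unfolding D_def using s C by (intro leb01.finite_measure_subadditive_countably) auto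
    also have "\<dots> \<le> (\<Sum>j. measure leb01 (C n) / 3 * (1/3)^j)"
      by (rule suminf_le[OF dec s sums_summable[OF g]])
    also have "\<dots> = measure leb01 (C n) / 2" using g by (rule sums_unique[symmetric])
    finally show ?thesis .
  qed
  show ?thesis
  proof (rule that[of B])
    show "B n \<in> sets leb01" for n unfolding B_def by measurable
    show "B n \<subseteq> A n" for n using CA by (auto simp: B_def)
    show "measure leb01 (B n) > 0" for n
    proof -
      have "measure leb01 (C n) \<le> measure leb01 (B n \<union> D n)"
        unfolding B_def by (rule leb01.finite_measure_mono) auto
      also have "\<dots> \<le> measure leb01 (B n) + measure leb01 (D n)"
        unfolding B_def by (rule measure_Un_le) measurable
      finally show ?thesis using Dle[of n] Cpos[of n] by linarith
    qed
    have lt: "B m \<inter> B n = {}" if "m < n" for m n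
    proof -
      have "C n \<subseteq> D m" using le_Suc_ex[of "Suc m" n] that unfolding D_def by auto
      then show ?thesis by (auto simp: B_def)
    qed
    then show "disjoint_family B"
      unfolding disjoint_family_on_def using Int_commute by (metis linorder_neqE_nat)
  qed
qed

section \<open>Quotients by separable subspaces\<close>

text \<open>
  The central step for separable subspaces. On a set of positive measure \<open>f - y n\<close> exceeds \<open>d\<close> in
  absolute value; if \<open>g\<close> equals its sign on any part of positive measure of that set, then
  \<open>\<parallel>f + g - y n\<parallel> \<ge> d + 1\<close>. Countably many \<open>y n\<close> can be treated at once on disjoint sets, and there is even
  room for infinitely many disjoint copies \<open>U k\<close> of such a system of sets. Overwriting \<open>g0\<close> on one of
  them hardly changes the value of \<open>\<phi>\<close>.
\<close>

lemma modify_on_small_set: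
  fixes y :: "nat \<Rightarrow> linf01"
  assumes \<phi>: "bounded_linear (\<phi> :: linf01 \<Rightarrow> real)" and g0: "norm g0 \<le> 1"
    and far: "\<And>n. d < norm (f - y n)" and e: "e > 0"
  obtains g where "norm g \<le> 1" "\<phi> g0 - e \<le> \<phi> g" "\<And>n. d + 1 \<le> norm (f + g - y n)"
proof -
  let ?h = "\<lambda>n. rep_linf01 (f - y n)"
  let ?A = "\<lambda>n. {x \<in> space leb01. d < \<bar>?h n x\<bar>}"
  have A: "?A n \<in> sets leb01" for n by measurable
  obtain B where B[measurable]: "\<And>i. B i \<in> sets leb01"
    and BA: "\<And>i. B i \<subseteq> ?A (fst (prod_decode i))"
    and Bpos: "\<And>i. measure leb01 (B i) > 0" and disj: "disjoint_family B"
    by (rule disjoint_positive_subsets[of "\<lambda>i. ?A (fst (prod_decode i))", OF A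
          measure_gt_norm_pos[OF far]]) (rule that; assumption)
  have uniq: "i = j" if "x \<in> B i" "x \<in> B j" for x i j
    using disjoint_family_onD[OF disj UNIV_I UNIV_I, of i j] that by auto
  define U where "U k = (\<Union>n. B (prod_encode (n, k)))" for k
  have U[measurable]: "U k \<in> sets leb01" for k unfolding U_def by measurable
  have disjU: "disjoint_family U"
    unfolding disjoint_family_on_def
  proof (intro ballI impI equals0I)
    fix a b x assume "a \<noteq> b" and "x \<in> U a \<inter> U b"
    then obtain m n where "x \<in> B (prod_encode (m, a))" "x \<in> B (prod_encode (n, b))"
      by (auto simp: U_def)
    then have "prod_encode (m, a) = prod_encode (n, b)" by (rule uniq)
    with \<open>a \<noteq> b\<close> show False by (simp add: prod_encode_eq)
  qed
  define j where "j x = (LEAST i. x \<in> B i)" for x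
  have j: "j x = i" if "x \<in> B i" for x i
    unfolding j_def using that uniq by (intro Least_equality) auto
  have [measurable]: "j \<in> measurable leb01 (count_space UNIV)"
    unfolding j_def by (rule measurable_Least) measurable
  define s :: "real \<Rightarrow> real" where
    "s x = (if 0 \<le> ?h (fst (prod_decode (j x))) x then 1 else - 1)" for x
  have "(\<lambda>x. ?h (fst (prod_decode (j x))) x) \<in> borel_measurable leb01"
    by (rule measurable_compose_countable[where g = j]) simp_all
  then have "s \<in> borel_measurable leb01"
    unfolding s_def by measurable
  then have s: "ess_bounded01 s"
    by (rule ess_bounded01_I[where C = 1]) (simp add: s_def)
  let ?p = "abs_linf01 s - g0"
  obtain k where k: "\<bar>\<phi> (restr01 (U k) ?p)\<bar> \<le> e"
    using exists_small_restriction[OF \<phi> U disjU e, of ?p] by blast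
  define g where "g = g0 + restr01 (U k) ?p"
  have g: "AE x in leb01. rep_linf01 g x =
      rep_linf01 g0 x + indicator (U k) x * (s x - rep_linf01 g0 x)"
    using rep_add_AE[of g0 "restr01 (U k) ?p"] rep_restr_AE[OF U, of k ?p]
      rep_diff_AE[of "abs_linf01 s" g0] rep_abs_AE[OF s] unfolding g_def[symmetric]
    by eventually_elim simp
  show ?thesis
  proof (rule that[of g])
    show "norm g \<le> 1"
    proof (rule norm_leI)
      show "AE x in leb01. \<bar>rep_linf01 g x\<bar> \<le> 1"
        using g norm_AE[of g0] by eventually_elim (use g0 in \<open>auto simp: indicator_def s_def\<close>)
    qed
    show "\<phi> g0 - e \<le> \<phi> g"
      using k by (simp add: g_def bounded_linear.linear[OF \<phi>] linear_add)
    show "d + 1 \<le> norm (f + g - y n)" for n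
    proof (rule norm_geI[OF B Bpos])
      let ?B = "B (prod_encode (n, k))"
      have eq: "f + g - y n = (f - y n) + g" by simp
      show "AE x in leb01. x \<in> ?B \<longrightarrow> d + 1 \<le> \<bar>rep_linf01 (f + g - y n) x\<bar>"
        unfolding eq using g rep_add_AE[of "f - y n" g]
      proof (eventually_elim, intro impI)
        fix x assume gx: "rep_linf01 g x =
            rep_linf01 g0 x + indicator (U k) x * (s x - rep_linf01 g0 x)"
          and sum: "rep_linf01 (f - y n + g) x = ?h n x + rep_linf01 g x" and x: "x \<in> ?B"
        have "x \<in> U k" using x by (auto simp: U_def)
        then have "rep_linf01 g x = (if 0 \<le> ?h n x then 1 else - 1)"
          using gx j[OF x] by (simp add: s_def)
        moreover have "d < \<bar>?h n x\<bar>" using BA[of "prod_encode (n, k)"] x by auto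
        ultimately show "d + 1 \<le> \<bar>rep_linf01 (f - y n + g) x\<bar>"
          using sum by (auto split: if_splits)
      qed
    qed
  qed
qed

lemma infdist_less_witness:
  assumes "Y \<noteq> {}" "infdist x Y < r"
  obtains z where "z \<in> Y" "dist x z < r"
  using assms by (auto simp: infdist_notempty cINF_less_iff)

lemma nspace_functional_quot_map:
  assumes Y: "subspace Y" and \<phi>: "nspace_functional (quot_space Y) \<phi>"
  shows "bounded_linear (\<lambda>x. \<phi> (quot_map Y x))"
proof -
  have car: "quot_map Y x \<in> ncarrier (quot_space Y)" for x by (simp add: quot_space_def)
  obtain K where K: "\<And>x. \<bar>\<phi> (quot_map Y x)\<bar> \<le> K * infdist x Y"
    using \<phi> car quot_norm[OF Y] unfolding nspace_functional_def by metis
  show ?thesis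
  proof (rule bounded_linear_intro[where K = "\<bar>K\<bar>"])
    fix x z :: 'a and c :: real
    show "\<phi> (quot_map Y (x + z)) = \<phi> (quot_map Y x) + \<phi> (quot_map Y z)"
      using \<phi> car unfolding nspace_functional_def quot_add[OF Y, symmetric] by blast
    show "\<phi> (quot_map Y (c *\<^sub>R x)) = c *\<^sub>R \<phi> (quot_map Y x)"
      using \<phi> car unfolding nspace_functional_def quot_scale[OF Y, symmetric] by simp
    have "infdist x Y \<le> norm x"
      using infdist_le[OF subspace_0[OF Y], of x] by simp
    then have "K * infdist x Y \<le> \<bar>K\<bar> * norm x"
      by (intro mult_mono) (auto simp: infdist_nonneg)
    then show "norm (\<phi> (quot_map Y x)) \<le> norm x * \<bar>K\<bar>"
      using K[of x] by (simp add: mult.commute)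
  qed
qed

lemma daugavet_linf01: "daugavet_property (nspace_of (UNIV :: linf01 set))"
proof (rule normed_nspace.daugavet_propertyI)
  show "normed_nspace (nspace_of (UNIV :: linf01 set))"
    by (rule normed_nspace_of[OF subspace_UNIV])
  fix \<phi> :: "linf01 \<Rightarrow> real" and u v :: linf01 and \<epsilon> :: real
  assume \<phi>: "nspace_functional (nspace_of (UNIV :: linf01 set)) \<phi>"
    and v: "v \<in> nball (nspace_of UNIV)" and \<epsilon>: "\<epsilon> > 0"
  have "bounded_linear \<phi>"
    using \<phi> bounded_linear_intro[of \<phi>]
    by (auto simp: nspace_functional_def nspace_of_def mult.commute[of "norm _"])
  moreover have "norm v \<le> 1" using v by (simp add: nball_def nspace_of_def)
  moreover have "norm u - \<epsilon> < norm (u - 0)" using \<epsilon> by simp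
  ultimately obtain g where "norm g \<le> 1" "\<phi> v - \<epsilon> \<le> \<phi> g" "norm u - \<epsilon> + 1 \<le> norm (u + g - 0)"
    using modify_on_small_set[of \<phi> v "norm u - \<epsilon>" u "\<lambda>_. 0" \<epsilon>] \<epsilon> by blast
  then show "\<exists>g\<in>nball (nspace_of UNIV). \<phi> v - \<epsilon> \<le> \<phi> g \<and>
      nnorm (nspace_of UNIV) u + 1 - \<epsilon> \<le> nnorm (nspace_of UNIV) (nadd (nspace_of UNIV) u g)"
    by (intro bexI[of _ g]) (auto simp: nball_def nspace_of_def)
qed

text \<open>
  Distances to \<open>Y\<close> are controlled by those points of the countable set \<open>C\<close> that are close to \<open>Y\<close>, so one
  dense sequence of a separable space serves for all its subspaces.
\<close>

lemma daugavet_quotient_by_separable: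
  fixes Y C :: "linf01 set"
  assumes Y: "subspace Y" "closed Y" and C: "countable C" "Y \<subseteq> closure C"
  shows "daugavet_property (quot_space Y)"
proof (rule normed_nspace.daugavet_propertyI)
  let ?X = "quot_space Y"
  show nX: "normed_nspace ?X" by (rule normed_nspace_quot[OF Y])
  have car: "ncarrier ?X = range (quot_map Y)" by (simp add: quot_space_def)
  fix \<phi> u v and \<epsilon> :: real
  assume \<phi>: "nspace_functional ?X \<phi>" and u: "u \<in> ncarrier ?X" and v: "v \<in> nball ?X"
    and \<epsilon>: "\<epsilon> > 0"
  obtain f where f: "u = quot_map Y f" using u by (auto simp: car)
  obtain g1 where g1: "v = quot_map Y g1" "infdist g1 Y \<le> 1"
    using v by (auto simp: nball_def car quot_norm[OF Y(1)])
  let ?\<psi> = "\<lambda>x. \<phi> (quot_map Y x)"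
  have \<psi>: "bounded_linear ?\<psi>" by (rule nspace_functional_quot_map[OF Y(1) \<phi>])
  have Yne: "Y \<noteq> {}" using subspace_0[OF Y(1)] by blast
  \<comment> \<open>Rescaled to the unit ball, a nearly optimal representative of \<open>v\<close> changes \<open>\<phi> v\<close> only slightly.\<close>
  obtain K where K: "K > 0" "\<And>x. \<bar>?\<psi> x\<bar> \<le> norm x * K"
    using bounded_linear.pos_bounded[OF \<psi>] by auto
  define \<delta> where "\<delta> = \<epsilon> / (2 * K)"
  have \<delta>: "\<delta> > 0" using \<epsilon> K by (simp add: \<delta>_def)
  obtain z where z: "z \<in> Y" "dist g1 z < 1 + \<delta>"
    using infdist_less_witness[OF Yne, of g1 "1 + \<delta>"] g1(2) \<delta> by auto
  define g0 where "g0 = (1 / (1 + \<delta>)) *\<^sub>R (g1 - z)"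
  have ng0: "norm g0 \<le> 1" using z(2) \<delta> by (simp add: g0_def dist_norm)
  have \<psi>z: "?\<psi> (g1 - z) = ?\<psi> g1"
    using z(1) subspace_neg[OF Y(1)] quot_map_eq_iff[OF Y(1), of "g1 - z" g1] by simp
  have "?\<psi> g1 - ?\<psi> g0 \<le> \<epsilon> / 2"
  proof -
    have eq: "g1 - z = (1 + \<delta>) *\<^sub>R g0" using \<delta> by (simp add: g0_def)
    have "?\<psi> g1 = (1 + \<delta>) * ?\<psi> g0"
      unfolding \<psi>z[symmetric] eq by (simp add: bounded_linear.linear[OF \<psi>] linear_scale[of ?\<psi>])
    then have "?\<psi> g1 - ?\<psi> g0 = \<delta> * ?\<psi> g0" by (simp add: algebra_simps)
    also have "\<dots> \<le> \<delta> * K"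
    proof (rule mult_left_mono)
      show "?\<psi> g0 \<le> K"
        using K(2)[of g0] K(1) mult_right_mono[OF ng0, of K] by linarith
    qed (use \<delta> in simp)
    also have "\<dots> = \<epsilon> / 2" using K by (simp add: \<delta>_def)
    finally show ?thesis .
  qed
  then have \<psi>g0: "?\<psi> g1 - ?\<psi> g0 \<le> \<epsilon> / 2" .
  define d where "d = infdist f Y - \<epsilon> / 2"
  define C' where "C' = {c \<in> C. d < norm (f - c)}"
  have near: "\<exists>c\<in>C'. norm (c - x) < r" if x: "x \<in> Y" and r: "0 < r" "r \<le> \<epsilon> / 2" for x r
  proof -
    obtain c where c: "c \<in> C" "dist c x < r"
      using subsetD[OF C(2) x] r(1) unfolding closure_approachable by blast
    have "infdist f Y \<le> dist f x" by (rule infdist_le[OF x])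
    also have "\<dots> \<le> norm (f - c) + dist c x" using dist_triangle[of f x c] by (simp add: dist_norm)
    finally show ?thesis using c r by (intro bexI[of _ c]) (auto simp: C'_def d_def dist_norm)
  qed
  have "C' \<noteq> {}" using near[OF subspace_0[OF Y(1)], of "\<epsilon> / 2"] \<epsilon> by auto
  moreover have "countable C'" using C(1) by (simp add: C'_def)
  ultimately have y: "range (from_nat_into C') = C'" by (rule range_from_nat_into)
  let ?y = "from_nat_into C'"
  have far: "d < norm (f - ?y n)" for n using rangeI[of ?y n] unfolding y by (simp add: C'_def)
  obtain g where g: "norm g \<le> 1" "?\<psi> g0 - \<epsilon> / 2 \<le> ?\<psi> g" "\<And>n. d + 1 \<le> norm (f + g - ?y n)"
    by (rule modify_on_small_set[of ?\<psi> g0 d f ?y, OF \<psi> ng0 far half_gt_zero[OF \<epsilon>]])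
      (rule that; assumption)
  have "d + 1 \<le> infdist (f + g) Y"
    unfolding infdist_notempty[OF Yne]
  proof (rule cINF_greatest[OF Yne], rule field_le_epsilon)
    fix x and r :: real assume x: "x \<in> Y" and r: "r > 0"
    have "0 < min r (\<epsilon> / 2)" using r \<epsilon> by simp
    then obtain c where c: "c \<in> C'" "norm (c - x) < min r (\<epsilon> / 2)"
      using near[OF x _ min.cobounded2] by blast
    have "c \<in> range ?y" using c(1) y by simp
    then obtain n where "c = ?y n" by (rule rangeE)
    then have "d + 1 \<le> norm (f + g - c)" using g(3)[of n] by simp
    also have "\<dots> \<le> norm (f + g - x) + norm (x - c)"
      using norm_triangle_ineq[of "f + g - x" "x - c"] by simp
    finally show "d + 1 \<le> dist (f + g) x + r" using c by (simp add: dist_norm norm_minus_commute)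
  qed
  moreover have "infdist g Y \<le> 1"
    using infdist_le[OF subspace_0[OF Y(1)], of g] g(1) by simp
  ultimately show "\<exists>g\<in>nball ?X. \<phi> v - \<epsilon> \<le> \<phi> g \<and> nnorm ?X u + 1 - \<epsilon> \<le> nnorm ?X (nadd ?X u g)"
    using g(2) \<psi>g0 \<epsilon> unfolding f g1(1)
    by (intro bexI[of _ "quot_map Y g"])
      (auto simp: nball_def car quot_add[OF Y(1)] quot_norm[OF Y(1)] d_def)
qed

lemma separable_imp_poor:
  fixes Z :: "linf01 set"
  assumes Z: "subspace Z" "closed Z" and sep: "separable_space (top_of_set Z)"
  shows "poor Z"
proof -
  obtain C where C: "countable C" "C \<subseteq> Z" "top_of_set Z closure_of C = Z"
    using sep unfolding separable_space_def by auto
  then have "Z \<subseteq> closure C"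
    using closure_mono[of "Z \<inter> C" C] by (auto simp: closure_of_subtopology)
  then show ?thesis
    unfolding poor_def
    using Z daugavet_linf01 daugavet_quotient_by_separable[OF _ _ C(1)] by (meson order_trans)
qed

section \<open>Subspaces that are large on the upper half of the interval\<close>

abbreviation upper_half :: "real set" where "upper_half \<equiv> {1/2..1}"

lemma upper_half_sets [measurable]: "upper_half \<in> sets leb01"
  by (simp add: sets_restrict_space_iff)

text \<open>
  The average over the upper half, which has measure 1/2: a functional of norm 1 that is attained at the
  indicator function of the upper half.
\<close>

definition upper_mean :: "linf01 \<Rightarrow> real" where
  "upper_mean f = (LINT x|leb01. 2 * (indicator upper_half x * rep_linf01 f x))"

lemma upper_mean_integrable: "integrable leb01 (\<lambda>x. 2 * (indicator upper_half x * rep_linf01 f x))"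
proof (rule leb01.integrable_const_bound[where B = "2 * norm f"])
  show "AE x in leb01. norm (2 * (indicator upper_half x * rep_linf01 f x)) \<le> 2 * norm f"
    using norm_AE[of f] by eventually_elim (auto simp: indicator_def)
qed measurable

lemma upper_mean_mono:
  assumes "AE x in leb01. x \<in> upper_half \<longrightarrow> rep_linf01 f x \<le> rep_linf01 g x"
  shows "upper_mean f \<le> upper_mean g"
  unfolding upper_mean_def
  using assms by (intro integral_mono_AE upper_mean_integrable) (auto simp: indicator_def)

lemma upper_mean_const:
  assumes "AE x in leb01. x \<in> upper_half \<longrightarrow> rep_linf01 f x = c"
  shows "upper_mean f = c"
proof -
  have "upper_mean f = (LINT x|leb01. indicator upper_half x * (2 * c))"
    unfolding upper_mean_def
  proof (rule integral_cong_AE)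
    show "AE x in leb01. 2 * (indicator upper_half x * rep_linf01 f x) = indicator upper_half x * (2 * c)"
      using assms by eventually_elim (auto simp: indicator_def)
  qed measurable
  also have "\<dots> = measure leb01 upper_half * (2 * c)"
    by (simp add: sets.Int_space_eq2)
  also have "measure leb01 upper_half = measure lebesgue upper_half"
    by (rule measure_restrict_space) auto
  finally show ?thesis by simp
qed

lemma linear_upper_mean: "linear upper_mean"
proof (rule linearI)
  fix f g :: linf01 and c :: real
  have "upper_mean (f + g) = (LINT x|leb01. 2 * (indicator upper_half x * rep_linf01 f x) +
      2 * (indicator upper_half x * rep_linf01 g x))"
    unfolding upper_mean_def
    by (intro integral_cong_AE) (use rep_add_AE[of f g] in \<open>auto simp: algebra_simps\<close>)
  also have "\<dots> = upper_mean f + upper_mean g"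
    unfolding upper_mean_def by (intro Bochner_Integration.integral_add upper_mean_integrable)
  finally show "upper_mean (f + g) = upper_mean f + upper_mean g" .
  have "upper_mean (c *\<^sub>R f) = (LINT x|leb01. c * (2 * (indicator upper_half x * rep_linf01 f x)))"
    unfolding upper_mean_def
    by (intro integral_cong_AE) (use rep_scale_AE[of c f] in auto)
  then show "upper_mean (c *\<^sub>R f) = c *\<^sub>R upper_mean f"
    unfolding upper_mean_def by simp
qed

lemma rep_le_norm_restr_upper:
  "AE x in leb01. x \<in> upper_half \<longrightarrow> \<bar>rep_linf01 f x\<bar> \<le> norm (restr01 upper_half f)"
  using rep_restr_AE[OF upper_half_sets, of f] norm_AE[of "restr01 upper_half f"]
  by eventually_elim auto

definition const01 :: linf01 where "const01 = abs_linf01 (\<lambda>x. 1)"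

lemma rep_const01_AE: "AE x in leb01. rep_linf01 const01 x = 1"
  unfolding const01_def by (rule rep_abs_AE, rule ess_bounded01_I[where C = 1]) auto

lemma rep_indicator_AE:
  assumes "A \<in> sets leb01"
  shows "AE x in leb01. rep_linf01 (restr01 A const01) x = indicator A x"
  using rep_restr_AE[OF assms, of const01] rep_const01_AE by eventually_elim simp

lemma norm_indicator_le:
  assumes "A \<in> sets leb01"
  shows "norm (restr01 A const01) \<le> 1"
  by (rule norm_leI)
    (use rep_indicator_AE[OF assms] in eventually_elim, auto simp: indicator_def)

lemma abs_upper_mean_le: "\<bar>upper_mean f\<bar> \<le> norm (restr01 upper_half f)"
proof -
  let ?c = "norm (restr01 upper_half f)"
  have up: "upper_mean g \<le> ?c" if g: "AE x in leb01. x \<in> upper_half \<longrightarrow> rep_linf01 g x \<le> ?c" for g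
  proof -
    have "AE x in leb01. rep_linf01 (?c *\<^sub>R const01) x = ?c"
      using rep_scale_AE[of ?c const01] rep_const01_AE by eventually_elim simp
    then have "upper_mean (?c *\<^sub>R const01) = ?c"
      and "AE x in leb01. x \<in> upper_half \<longrightarrow> rep_linf01 g x \<le> rep_linf01 (?c *\<^sub>R const01) x"
      using g by (auto intro!: upper_mean_const)
    then show ?thesis using upper_mean_mono[of g "?c *\<^sub>R const01"] by linarith
  qed
  have "upper_mean f \<le> ?c"
    using rep_le_norm_restr_upper[of f] by (intro up) auto
  moreover have "upper_mean (-1 *\<^sub>R f) \<le> ?c"
    using rep_le_norm_restr_upper[of f] rep_scale_AE[of "-1" f] by (intro up) auto
  then have "- upper_mean f \<le> ?c"
    unfolding linear_scale[OF linear_upper_mean] by simp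
  ultimately show ?thesis by linarith
qed

lemma norm_restr01_le: "A \<in> sets leb01 \<Longrightarrow> norm (restr01 A f) \<le> norm f"
  by (rule norm_leI) (use rep_restr_AE[of A f] norm_AE[of f] in \<open>auto simp: indicator_def\<close>)

lemma bounded_linear_upper_mean: "bounded_linear upper_mean"
proof -
  have "\<bar>upper_mean f\<bar> \<le> norm f * 1" for f
    using abs_upper_mean_le[of f] norm_restr01_le[OF upper_half_sets, of f] by simp
  then show ?thesis
    using linear_upper_mean
    by (intro bounded_linear.intro bounded_linear_axioms.intro exI[of _ 1]) auto
qed

text \<open>
  The quotient version of \<open>daugavet_propertyD\<close>, with the class of norm at most 1 replaced by a representative
  in the unit ball of the whole space, at the cost of a slightly smaller lower bound.
\<close>

lemma daugavet_quotientD: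
  fixes Y :: "'a::real_normed_vector set"
  assumes Y: "subspace Y" "closed Y" and D: "daugavet_property (quot_space Y)"
    and \<phi>: "bounded_linear \<phi>" and \<phi>Y: "\<And>y. y \<in> Y \<Longrightarrow> \<phi> y = 0"
    and \<phi>1: "\<And>x. \<bar>\<phi> x\<bar> \<le> norm x" and u: "norm u \<le> 1" "\<phi> u = 1" and \<epsilon>: "0 < \<epsilon>" "\<epsilon> \<le> 1"
  obtains g where "norm g \<le> 1" "\<And>y. y \<in> Y \<Longrightarrow> 2 - \<epsilon> < norm (g - \<phi> g *\<^sub>R u - y)"
proof -
  let ?X = "quot_space Y"
  have nX: "normed_nspace ?X" by (rule normed_nspace_quot[OF Y])
  note lin = bounded_linear.linear[OF \<phi>]
  have Yne: "Y \<noteq> {}" using subspace_0[OF Y(1)] by blast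
  have car: "ncarrier ?X = range (quot_map Y)" by (simp add: quot_space_def)
  define \<psi> where "\<psi> A = \<phi> (SOME x. A = quot_map Y x)" for A
  have \<psi>: "\<psi> (quot_map Y x) = \<phi> x" for x
  proof -
    have "quot_map Y x = quot_map Y (SOME z. quot_map Y x = quot_map Y z)" by (rule someI) simp
    then have "\<phi> (x - (SOME z. quot_map Y x = quot_map Y z)) = 0"
      using quot_map_eq_iff[OF Y(1)] \<phi>Y by blast
    then show ?thesis by (simp add: \<psi>_def linear_diff[OF lin])
  qed
  have \<phi>inf: "\<bar>\<phi> x\<bar> \<le> infdist x Y" for x
    unfolding infdist_notempty[OF Yne]
  proof (rule cINF_greatest[OF Yne])
    fix y assume "y \<in> Y"
    then show "\<bar>\<phi> x\<bar> \<le> dist x y"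
      using \<phi>1[of "x - y"] \<phi>Y by (simp add: dist_norm linear_diff[OF lin])
  qed
  have func: "nspace_functional ?X \<psi>"
    unfolding nspace_functional_def car
  proof (intro conjI)
    show "\<exists>K. \<forall>A\<in>range (quot_map Y). \<bar>\<psi> A\<bar> \<le> K * nnorm ?X A"
      using \<phi>inf by (intro exI[of _ 1]) (auto simp: \<psi> quot_norm[OF Y(1)])
  qed (auto simp: \<psi> quot_add[OF Y(1)] quot_scale[OF Y(1)] linear_add[OF lin] linear_scale[OF lin])
  have "infdist u Y = 1"
    using \<phi>inf[of u] u infdist_le[OF subspace_0[OF Y(1)], of u] by simp
  note nu = this
  obtain A where A: "A \<in> nball ?X"
    "2 - \<epsilon> / 4 < nnorm ?X (nadd ?X A (nscale ?X (- \<psi> A) (quot_map Y u)))"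
  proof (rule normed_nspace.daugavet_propertyD[OF nX D func, of "quot_map Y u" "\<epsilon> / 4"])
    show "\<bar>\<psi> A\<bar> \<le> nnorm ?X A" if "A \<in> ncarrier ?X" for A
      using that \<phi>inf by (auto simp: car \<psi> quot_norm[OF Y(1)])
  qed (use u nu \<epsilon> that in \<open>auto simp: car \<psi> quot_norm[OF Y(1)]\<close>)
  obtain g1 where g1: "A = quot_map Y g1" using A(1) by (auto simp: nball_def car)
  have g1': "infdist g1 Y \<le> 1" using A(1) by (simp add: g1 nball_def quot_norm[OF Y(1)])
  have far: "2 - \<epsilon> / 4 < infdist (g1 - \<phi> g1 *\<^sub>R u) Y"
    using A(2) by (simp add: g1 \<psi> quot_add[OF Y(1)] quot_scale[OF Y(1)] quot_norm[OF Y(1)])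
  obtain z where z: "z \<in> Y" "dist g1 z < 1 + \<epsilon> / 4"
    using infdist_less_witness[OF Yne, of g1 "1 + \<epsilon> / 4"] g1' \<epsilon> by auto
  define r where "r = 1 + \<epsilon> / 4"
  have r: "r > 0" using \<epsilon> by (simp add: r_def)
  define g where "g = (1 / r) *\<^sub>R (g1 - z)"
  show ?thesis
  proof (rule that[of g])
    show "norm g \<le> 1" using z(2) r by (simp add: g_def dist_norm r_def)
    fix y assume y: "y \<in> Y"
    have gr: "r *\<^sub>R g = g1 - z" using r by (simp add: g_def)
    have "r * \<phi> g = \<phi> g1"
      using linear_scale[OF lin, of r g] gr \<phi>Y[OF z(1)] by (simp add: linear_diff[OF lin])
    then have "r *\<^sub>R (g - \<phi> g *\<^sub>R u - y) = g1 - \<phi> g1 *\<^sub>R u - (z + r *\<^sub>R y)"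
      using gr by (simp add: scaleR_diff_right)
    moreover have "2 - \<epsilon> / 4 < dist (g1 - \<phi> g1 *\<^sub>R u) (z + r *\<^sub>R y)"
      using far infdist_le[of "z + r *\<^sub>R y" Y "g1 - \<phi> g1 *\<^sub>R u"] z y
      by (simp add: subspace_add[OF Y(1)] subspace_scale[OF Y(1)])
    ultimately have "2 - \<epsilon> / 4 < r * norm (g - \<phi> g *\<^sub>R u - y)"
      using r norm_scaleR[of r "g - \<phi> g *\<^sub>R u - y"] by (simp add: dist_norm)
    moreover have "r * (2 - \<epsilon>) \<le> 2 - \<epsilon> / 4"
      using \<epsilon> by (simp add: r_def algebra_simps)
    ultimately have "r * (2 - \<epsilon>) < r * norm (g - \<phi> g *\<^sub>R u - y)" by linarith
    then show "2 - \<epsilon> < norm (g - \<phi> g *\<^sub>R u - y)" using r by simp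
  qed
qed

text \<open>
  Suppose that \<open>Z\<close> were poor, and consider the quotient by \<open>Y = Z \<inter> ker upper_mean\<close>. The indicator \<open>u\<close> of the
  upper half has norm 1 there, since \<open>upper_mean u = 1\<close>. The Daugavet property yields \<open>g\<close> in the unit
  ball whose mean \<open>c\<close> is close to 1 and for which \<open>g - c u\<close> has distance almost 2 from \<open>Y\<close>. But
  \<open>\<bar>g - c u\<bar>\<close> exceeds \<open>2 - \<tau>\<close> only on the set \<open>A\<close> of points of the upper half at which \<open>g \<le> - 1 + \<tau>\<close>.
  This set is small, because the mean of \<open>g\<close> is close to 1. Some \<open>z\<close> in \<open>Z\<close> is approximately \<open>- \<tau>\<close> on \<open>A\<close> and
  approximately 0 on the rest of the upper half; subtracting it brings \<open>\<bar>g - c u\<bar>\<close> down to about \<open>2 - \<tau>\<close> on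
  the upper half and does no harm on the lower half, where \<open>u\<close> vanishes and \<open>z\<close> is small. As \<open>A\<close> is small,
  \<open>z\<close> has almost mean 0, and a small multiple of a fixed \<open>z0\<close> moves it into \<open>Y\<close>. This contradicts the
  distance from \<open>Y\<close>.
\<close>

lemma not_poor_if_restriction_dense:
  fixes Z :: "linf01 set"
  assumes \<delta>: "0 < \<delta>" "\<delta> \<le> 1"
    and dense: "\<And>h \<eta>. norm h \<le> \<delta> \<Longrightarrow> \<eta> > 0 \<Longrightarrow> \<exists>z\<in>Z. norm z \<le> 1 \<and> norm (restr01 upper_half (z - h)) \<le> \<eta>"
  shows "\<not> poor Z"
proof
  assume "poor Z"
  then have Z: "subspace Z" "closed Z"
    and D: "\<And>Y. subspace Y \<Longrightarrow> closed Y \<Longrightarrow> Y \<subseteq> Z \<Longrightarrow> daugavet_property (quot_space Y)"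
    unfolding poor_def by blast+
  note lin = linear_upper_mean
  note rlin = bounded_linear.linear[OF bounded_linear_restr01[OF upper_half_sets]]
  \<comment> \<open>With the factor 1/4 the elements \<open>z\<close> and \<open>z0\<close> below have norm at most 1/4, which leaves room on the lower half.\<close>
  define \<tau> where "\<tau> = \<delta> / 4"
  have \<tau>: "0 < \<tau>" "\<tau> \<le> 1/4" using \<delta> by (simp_all add: \<tau>_def)
  define \<eta> where "\<eta> = \<tau>\<^sup>2 / 8"
  have \<eta>: "0 < \<eta>" "\<eta> \<le> \<tau> / 32"
    using \<tau> by (simp_all add: \<eta>_def power2_eq_square)
  have approx: "\<exists>z\<in>Z. norm z \<le> 1/4 \<and> norm (restr01 upper_half (z - \<tau> *\<^sub>R h)) \<le> r"
    if h: "norm h \<le> 1" and r: "r > 0" for h r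
  proof -
    have "norm (\<delta> *\<^sub>R h) \<le> \<delta>" using h \<delta> by (simp add: mult_left_le)
    then obtain z where z: "z \<in> Z" "norm z \<le> 1" "norm (restr01 upper_half (z - \<delta> *\<^sub>R h)) \<le> 4 * r"
      using dense[of "\<delta> *\<^sub>R h" "4 * r"] r by auto
    have "(1/4) *\<^sub>R z - \<tau> *\<^sub>R h = (1/4) *\<^sub>R (z - \<delta> *\<^sub>R h)"
      by (simp add: \<tau>_def scaleR_diff_right)
    then have "norm (restr01 upper_half ((1/4) *\<^sub>R z - \<tau> *\<^sub>R h)) \<le> r"
      using z(3) by (simp only: linear_scale[OF rlin]) simp
    then show ?thesis
      using z subspace_scale[OF Z(1), of z "1/4"] by (intro bexI[of _ "(1/4) *\<^sub>R z"]) auto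
  qed
  define u where "u = restr01 upper_half const01"
  have u: "norm u \<le> 1" unfolding u_def by (rule norm_indicator_le[OF upper_half_sets])
  have u_AE: "AE x in leb01. rep_linf01 u x = indicator upper_half x"
    unfolding u_def by (rule rep_indicator_AE[OF upper_half_sets])
  have mu: "upper_mean u = 1" using u_AE by (intro upper_mean_const) (auto simp: indicator_def)
  define Y where "Y = Z \<inter> {f. upper_mean f = 0}"
  have Y: "subspace Y" "closed Y" "Y \<subseteq> Z"
    using Z subspace_inter[OF Z(1) linear_subspace_kernel[OF lin]]
      closed_Collect_eq[of upper_mean "\<lambda>_. 0"]
      linear_continuous_on[OF bounded_linear_upper_mean, of UNIV]
    by (auto simp: Y_def)
  have le1: "\<bar>upper_mean f\<bar> \<le> norm f" for f
    using abs_upper_mean_le[of f] norm_restr01_le[OF upper_half_sets, of f] by linarith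
  obtain g' where g': "norm g' \<le> 1"
    "\<And>y. y \<in> Y \<Longrightarrow> 2 - \<tau> / 4 < norm (g' - upper_mean g' *\<^sub>R u - y)"
    using daugavet_quotientD[OF Y(1,2) D[OF Y] bounded_linear_upper_mean _ le1 u mu, of "\<tau> / 4"] \<tau>
    by (auto simp: Y_def)
  \<comment> \<open>Changing the sign of \<open>g\<close> if necessary, its mean is nonnegative.\<close>
  obtain g where g: "norm g \<le> 1" "upper_mean g \<ge> 0"
    "\<And>y. y \<in> Y \<Longrightarrow> 2 - \<tau> / 4 < norm (g - upper_mean g *\<^sub>R u - y)"
  proof (cases "upper_mean g' \<ge> 0")
    case True
    then show ?thesis using that g' by blast
  next
    case False
    have "2 - \<tau> / 4 < norm (- g' - upper_mean (- g') *\<^sub>R u - y)" if "y \<in> Y" for y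
    proof -
      have "- g' - upper_mean (- g') *\<^sub>R u - y = - (g' - upper_mean g' *\<^sub>R u - - y)"
        by (simp add: linear_neg[OF lin])
      then show ?thesis using g'(2)[of "- y"] subspace_neg[OF Y(1) that] by (metis norm_minus_cancel)
    qed
    then show ?thesis using that[of "- g'"] g' False by (simp add: linear_neg[OF lin])
  qed
  define c where "c = upper_mean g"
  have c: "0 \<le> c" "c \<le> 1" using g le1[of g] by (simp_all add: c_def)
  have "2 - \<tau> / 4 < norm (g - c *\<^sub>R u)"
    using g(3)[OF subspace_0[OF Y(1)]] by (simp add: c_def)
  also have "\<dots> \<le> norm g + c * norm u"
    using norm_triangle_ineq4[of g "c *\<^sub>R u"] c by simp
  also have "\<dots> \<le> 1 + c * 1"
    using g(1) u c by (intro add_mono mult_left_mono) auto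
  finally have c1: "1 - \<tau> / 4 < c" by simp
  define A where "A = {x \<in> space leb01. x \<in> upper_half \<and> rep_linf01 g x \<le> - 1 + \<tau>}"
  have A[measurable]: "A \<in> sets leb01" unfolding A_def by measurable
  define a where "a = restr01 A const01"
  have a_AE: "AE x in leb01. rep_linf01 a x = indicator A x"
    unfolding a_def by (rule rep_indicator_AE[OF A])
  have mean_a: "0 \<le> upper_mean a" "upper_mean a \<le> \<tau> / 4"
  proof -
    have "upper_mean 0 \<le> upper_mean a"
      using a_AE rep_zero_AE by (intro upper_mean_mono) (auto simp: indicator_def)
    then show "0 \<le> upper_mean a" by (simp add: linear_0[OF lin])
    \<comment> \<open>On \<open>A\<close> the function \<open>1 - g\<close> is at least \<open>2 - \<tau> \<ge> 1\<close>, and it is nonnegative elsewhere.\<close>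
    have "AE x in leb01. x \<in> upper_half \<longrightarrow> rep_linf01 a x \<le> rep_linf01 (u - g) x"
      using a_AE u_AE norm_AE[of g] rep_diff_AE[of u g]
    proof eventually_elim
      case (elim x)
      then show ?case using g(1) \<tau> by (auto simp: A_def indicator_def)
    qed
    then have "upper_mean a \<le> upper_mean (u - g)" by (rule upper_mean_mono)
    then show "upper_mean a \<le> \<tau> / 4"
      using c1 mu by (simp add: linear_diff[OF lin] c_def)
  qed
  obtain z where z: "z \<in> Z" "norm z \<le> 1/4" "norm (restr01 upper_half (z - \<tau> *\<^sub>R (- a))) \<le> \<eta>"
    using approx[of "- a" \<eta>] norm_indicator_le[OF A] \<eta> by (auto simp: a_def)
  obtain z0 where z0: "z0 \<in> Z" "norm z0 \<le> 1/4" "norm (restr01 upper_half (z0 - \<tau> *\<^sub>R u)) \<le> \<tau> / 2"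
    using approx[OF u, of "\<tau> / 2"] \<tau> by auto
  have "\<bar>upper_mean z0 - \<tau>\<bar> \<le> \<tau> / 2"
    using abs_upper_mean_le[of "z0 - \<tau> *\<^sub>R u"] z0(3) mu
    by (simp add: linear_diff[OF lin] linear_scale[OF lin])
  then have mz0: "\<tau> / 2 \<le> upper_mean z0" by linarith
  have "\<bar>upper_mean z + \<tau> * upper_mean a\<bar> \<le> \<eta>"
    using abs_upper_mean_le[of "z - \<tau> *\<^sub>R (- a)"] z(3)
    by (simp add: linear_add[OF lin] linear_scale[OF lin])
  moreover have "\<bar>\<tau> * upper_mean a\<bar> \<le> \<tau> * (\<tau> / 4)"
    using mean_a \<tau> by (simp add: abs_mult)
  ultimately have "\<bar>upper_mean z\<bar> \<le> \<eta> + \<tau> * (\<tau> / 4)" by linarith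
  then have mz: "\<bar>upper_mean z\<bar> \<le> 3 * \<tau>\<^sup>2 / 8"
    by (simp add: \<eta>_def power2_eq_square)
  define t where "t = upper_mean z / upper_mean z0"
  have t: "\<bar>t\<bar> \<le> 3 * \<tau> / 4"
  proof -
    have "\<bar>t\<bar> = \<bar>upper_mean z\<bar> / upper_mean z0" using mz0 \<tau> by (simp add: t_def)
    also have "\<dots> \<le> (3 * \<tau>\<^sup>2 / 8) / (\<tau> / 2)"
      using mz mz0 \<tau> by (intro frac_le) auto
    also have "\<dots> = 3 * \<tau> / 4" using \<tau> by (simp add: power2_eq_square)
    finally show ?thesis .
  qed
  define y where "y = z - t *\<^sub>R z0"
  have "upper_mean y = 0"
    using mz0 \<tau> by (simp add: y_def linear_diff[OF lin] linear_scale[OF lin] t_def)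
  then have "y \<in> Y"
    using z(1) z0(1) Z(1) by (simp add: Y_def y_def subspace_diff subspace_scale)
  then have "2 - \<tau> / 4 < norm (g - c *\<^sub>R u - y)" using g(3) by (simp add: c_def)
  also have "g - c *\<^sub>R u - y = (g - c *\<^sub>R u - z) + t *\<^sub>R z0" by (simp add: y_def)
  also have "norm \<dots> \<le> norm (g - c *\<^sub>R u - z) + \<bar>t\<bar> * norm z0"
    using norm_triangle_ineq[of "g - c *\<^sub>R u - z" "t *\<^sub>R z0"] by simp
  also have "\<dots> \<le> (2 - \<tau> + \<eta>) + (3 * \<tau> / 4) * (1/4)"
  proof (intro add_mono mult_mono t z0)
    show "norm (g - c *\<^sub>R u - z) \<le> 2 - \<tau> + \<eta>"
    proof (rule norm_leI)
      show "AE x in leb01. \<bar>rep_linf01 (g - c *\<^sub>R u - z) x\<bar> \<le> 2 - \<tau> + \<eta>"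
        using rep_diff_AE[of "g - c *\<^sub>R u" z] rep_diff_AE[of g "c *\<^sub>R u"] rep_scale_AE[of c u] u_AE
          norm_AE[of g] norm_AE[of z] a_AE rep_diff_AE[of z "\<tau> *\<^sub>R (- a)"]
          rep_scale_AE[of \<tau> "- a"] rep_scale_AE[of "-1" a]
          rep_restr_AE[OF upper_half_sets, of "z - \<tau> *\<^sub>R (- a)"]
          norm_AE[of "restr01 upper_half (z - \<tau> *\<^sub>R (- a))"] AE_space
      proof eventually_elim
        case (elim x)
        have eq: "rep_linf01 (g - c *\<^sub>R u - z) x =
            rep_linf01 g x - c * indicator upper_half x - rep_linf01 z x"
          using elim by simp
        have gx: "\<bar>rep_linf01 g x\<bar> \<le> 1" and zx: "\<bar>rep_linf01 z x\<bar> \<le> 1/4"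
          using elim g(1) z(2) by linarith+
        show ?case
        proof (cases "x \<in> upper_half")
          case False
          then have "rep_linf01 (g - c *\<^sub>R u - z) x = rep_linf01 g x - rep_linf01 z x"
            by (simp add: eq)
          then show ?thesis using gx zx \<tau> \<eta> by linarith
        next
          case True
          have "\<bar>rep_linf01 z x + \<tau> * indicator A x\<bar> \<le> \<eta>"
            using elim z(3) True by simp
          moreover have "rep_linf01 (g - c *\<^sub>R u - z) x = rep_linf01 g x - c - rep_linf01 z x"
            using True by (simp add: eq)
          moreover have "x \<in> A \<longleftrightarrow> rep_linf01 g x \<le> - 1 + \<tau>"
            using True elim by (simp add: A_def)
          ultimately show ?thesis
            using gx c c1 \<tau> \<eta> by (cases "x \<in> A") (simp; linarith)+
        qed
      qed
    qed
  qed (use \<tau> in auto)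
  finally show False using \<eta> \<tau> by linarith
qed

section \<open>The functions supported on the lower half form a bank\<close>

text \<open>
  On the lower half the interval from \<open>1 / (k + 3)\<close> to \<open>1 / (k + 2)\<close> has floor of \<open>1 / x\<close> equal to \<open>k + 2\<close>, and the
  sign there is read off from the \<open>n\<close>-th binary digit of \<open>k\<close>. So every finite pattern of signs occurs on
  one of these intervals, as it does for the Rademacher functions.
\<close>

definition bit_sign :: "nat \<Rightarrow> real \<Rightarrow> real" where
  "bit_sign n x =
     (if x \<in> upper_half then 0 else if n \<in> set_decode (nat \<lfloor>1 / x\<rfloor> - 2) then 1 else - 1)"

lemma bit_sign_ess_bounded: "ess_bounded01 (bit_sign n)"
proof (rule ess_bounded01_I[where C = 1])
  have [measurable]: "(\<lambda>x::real. \<lfloor>1 / x\<rfloor>) \<in> borel \<rightarrow>\<^sub>M count_space UNIV"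
    by measurable
  have "bit_sign n \<in> borel_measurable borel"
    unfolding bit_sign_def by measurable
  then show "bit_sign n \<in> borel_measurable leb01"
    by (intro measurable_restrict_space1 measurable_completion) simp
qed (simp add: bit_sign_def)

definition rademacher01 :: "nat \<Rightarrow> linf01" where
  "rademacher01 n = abs_linf01 (bit_sign n)"

lemma rep_rademacher01_AE: "AE x in leb01. rep_linf01 (rademacher01 n) x = bit_sign n x"
  unfolding rademacher01_def by (rule rep_abs_AE[OF bit_sign_ess_bounded])

lemma norm_rademacher01: "norm (rademacher01 n) \<le> 1"
  by (rule norm_leI) (use rep_rademacher01_AE[of n] in eventually_elim, simp add: bit_sign_def)

lemma restr01_rademacher01: "restr01 upper_half (rademacher01 n) = 0"
  by (rule eq_AE)
    (use rep_restr_AE[OF upper_half_sets, of "rademacher01 n"] rep_rademacher01_AE[of n] rep_zero_AE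
      in eventually_elim, auto simp: bit_sign_def indicator_def)

text \<open>
  The signs of the coefficients are realised simultaneously on an interval of positive length.
\<close>

lemma sum_abs_le_norm_rademacher01:
  "(\<Sum>n<N. \<bar>a n\<bar>) \<le> norm (\<Sum>n<N. a n *\<^sub>R rademacher01 n)"
proof -
  define k where "k = set_encode {n. n < N \<and> 0 \<le> a n}"
  have dec: "n \<in> set_decode k \<longleftrightarrow> n < N \<and> 0 \<le> a n" for n
    by (simp add: k_def)
  define B where "B = {1 / (real k + 3)<..<1 / (real k + 2)}"
  have B01: "B \<subseteq> {0..1}"
  proof
    fix x assume x: "x \<in> B"
    have "0 < 1 / (real k + 3)" "1 / (real k + 2) \<le> 1" by simp_all
    then have "0 \<le> x \<and> x \<le> 1" using x unfolding B_def greaterThanLessThan_iff by linarith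
    then show "x \<in> {0..1}" by simp
  qed
  have sign: "bit_sign n x = (if n \<in> set_decode k then 1 else - 1)" if x: "x \<in> B" for n x
  proof -
    have x0: "0 < x"
      using x zero_less_divide_1_iff[of "real k + 3"] unfolding B_def greaterThanLessThan_iff
      by linarith
    have fl: "real k + 2 < 1 / x" "1 / x < real k + 3"
      using x x0 by (auto simp: B_def field_simps)
    then have "\<lfloor>1 / x\<rfloor> = int k + 2" by (intro floor_unique) auto
    moreover have "x \<notin> upper_half"
    proof -
      have "1 / (real k + 2) \<le> 1 / 2" by (intro frac_le) auto
      then have "x < 1 / 2" using x unfolding B_def greaterThanLessThan_iff by linarith
      then show ?thesis by simp
    qed
    ultimately show ?thesis by (simp add: bit_sign_def nat_add_distrib)
  qed
  show ?thesis
  proof (rule norm_geI)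
    show "B \<in> sets leb01" using B01 by (simp add: sets_restrict_space_iff B_def)
    have "measure leb01 B = measure lebesgue B"
      using B01 by (intro measure_restrict_space) (auto simp: B_def)
    also have "\<dots> = 1 / (real k + 2) - 1 / (real k + 3)"
      unfolding B_def by (simp add: frac_le)
    also have "\<dots> > 0" by (simp add: frac_less2)
    finally show "0 < measure leb01 B" .
    have "AE x in leb01. \<forall>n. rep_linf01 (rademacher01 n) x = bit_sign n x"
      unfolding AE_all_countable using rep_rademacher01_AE by blast
    moreover have "AE x in leb01. \<forall>n. rep_linf01 (a n *\<^sub>R rademacher01 n) x =
        a n * rep_linf01 (rademacher01 n) x"
      unfolding AE_all_countable using rep_scale_AE by blast
    moreover note rep_sum_AE[OF finite_lessThan[of N], of "\<lambda>n. a n *\<^sub>R rademacher01 n"]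
    ultimately show "AE x in leb01. x \<in> B \<longrightarrow>
        (\<Sum>n<N. \<bar>a n\<bar>) \<le> \<bar>rep_linf01 (\<Sum>n<N. a n *\<^sub>R rademacher01 n) x\<bar>"
    proof eventually_elim
      case (elim x)
      have "(\<Sum>n<N. a n * bit_sign n x) = (\<Sum>n<N. \<bar>a n\<bar>)" if "x \<in> B"
        by (rule sum.cong) (auto simp: sign[OF that] dec)
      then show ?case using elim by (simp add: abs_of_nonneg sum_nonneg)
    qed
  qed
qed

definition lower_half :: "linf01 set" where
  "lower_half = {f. restr01 upper_half f = 0}"

lemma subspace_lower_half: "subspace lower_half"
  unfolding lower_half_def
  by (rule linear_subspace_kernel[OF bounded_linear.linear[OF bounded_linear_restr01[OF upper_half_sets]]])

lemma closed_lower_half: "closed lower_half"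
  unfolding lower_half_def
  by (intro closed_Collect_eq linear_continuous_on[OF bounded_linear_restr01[OF upper_half_sets]]
      continuous_on_const)

lemma norm_restr_le_infdist: "norm (restr01 upper_half f) \<le> infdist f lower_half"
proof -
  have ne: "lower_half \<noteq> {}" using subspace_0[OF subspace_lower_half] by blast
  note rlin = bounded_linear.linear[OF bounded_linear_restr01[OF upper_half_sets]]
  show ?thesis
    unfolding infdist_notempty[OF ne]
  proof (rule cINF_greatest[OF ne])
    fix e assume "e \<in> lower_half"
    then have "restr01 upper_half (f - e) = restr01 upper_half f"
      by (simp add: lower_half_def linear_diff[OF rlin])
    then show "norm (restr01 upper_half f) \<le> dist f e"
      using norm_restr01_le[OF upper_half_sets, of "f - e"] by (simp add: dist_norm)
  qed
qed

text \<open>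
  The sign functions span an isometric copy of the space of absolutely summable sequences: the norm of a
  combination is at most the sum of the absolute values of its coefficients, and at least this sum by
  \<open>sum_abs_le_norm_rademacher01\<close>.
\<close>

lemma contains_ell1_lower_half: "contains_ell1 lower_half"
proof -
  let ?L = "{a :: nat \<Rightarrow> real. summable (\<lambda>n. \<bar>a n\<bar>)}"
  have car: "ncarrier ell1 = ?L" by (simp add: ell1_def)
  define T where "T a = (\<Sum>n. a n *\<^sub>R rademacher01 n)" for a :: "nat \<Rightarrow> real"
  have bound: "norm (a n *\<^sub>R rademacher01 n) \<le> \<bar>a n\<bar>" for a n
    using mult_left_mono[OF norm_rademacher01[of n], of "\<bar>a n\<bar>"] by simp
  have sn: "summable (\<lambda>n. norm (a n *\<^sub>R rademacher01 n))" if "a \<in> ?L" for a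
  proof (rule summable_comparison_test')
    show "summable (\<lambda>n. \<bar>a n\<bar>)" using that by simp
    show "norm (norm (a n *\<^sub>R rademacher01 n)) \<le> \<bar>a n\<bar>" if "0 \<le> n" for n
      using bound[of a n] by simp
  qed
  have s: "summable (\<lambda>n. a n *\<^sub>R rademacher01 n)" if "a \<in> ?L" for a
    by (rule summable_norm_cancel[OF sn[OF that]])
  have upper: "norm (T a) \<le> (\<Sum>n. \<bar>a n\<bar>)" if a: "a \<in> ?L" for a
  proof -
    have "norm (T a) \<le> (\<Sum>n. norm (a n *\<^sub>R rademacher01 n))"
      unfolding T_def by (rule summable_norm[OF sn[OF a]])
    also have "\<dots> \<le> (\<Sum>n. \<bar>a n\<bar>)"
      using a by (intro suminf_le[OF bound sn]) simp_all
    finally show ?thesis .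
  qed
  have lower: "(\<Sum>n. \<bar>a n\<bar>) \<le> norm (T a)" if a: "a \<in> ?L" for a
  proof (rule LIMSEQ_le)
    show "(\<lambda>N. \<Sum>n<N. \<bar>a n\<bar>) \<longlonglongrightarrow> (\<Sum>n. \<bar>a n\<bar>)"
      using a by (intro summable_LIMSEQ) simp
    show "(\<lambda>N. norm (\<Sum>n<N. a n *\<^sub>R rademacher01 n)) \<longlonglongrightarrow> norm (T a)"
      unfolding T_def by (intro tendsto_norm summable_LIMSEQ s a)
  qed (intro exI[of _ 0] allI impI sum_abs_le_norm_rademacher01)
  have add: "T (\<lambda>n. a n + b n) = T a + T b" if "a \<in> ?L" "b \<in> ?L" for a b
    unfolding T_def using suminf_add[OF s[OF that(1)] s[OF that(2)]] by (simp add: scaleR_add_left)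
  have scale: "T (\<lambda>n. c * a n) = c *\<^sub>R T a" if "a \<in> ?L" for a c
    unfolding T_def using suminf_scaleR_right[OF s[OF that], of c] by simp
  interpret ell1: normed_nspace ell1 by (rule normed_nspace_ell1)
  have addL: "(\<lambda>n. a n + b n) \<in> ?L" if "a \<in> ?L" "b \<in> ?L" for a b
    using ell1.add_closed[of a b] that by (simp add: ell1_def)
  have scaleL: "(\<lambda>n. c * a n) \<in> ?L" if "a \<in> ?L" for a c
    using ell1.scale_closed[of a c] that by (simp add: ell1_def)
  have inj: "inj_on T ?L"
  proof (rule inj_onI)
    fix a b assume ab: "a \<in> ?L" "b \<in> ?L" "T a = T b"
    let ?d = "\<lambda>n. a n + - 1 * b n"
    have d: "?d \<in> ?L" by (intro addL scaleL ab)
    have "T ?d = 0" using ab by (simp only: add scaleL scale) simp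
    then have "(\<Sum>n. \<bar>?d n\<bar>) = 0"
      using lower[OF d] suminf_nonneg[of "\<lambda>n. \<bar>?d n\<bar>"] d by simp
    then have "\<forall>n. \<bar>?d n\<bar> = 0"
      using d by (subst (asm) suminf_eq_zero_iff) auto
    then show "a = b" by auto
  qed
  define Y where "Y = T ` ?L"
  have Y: "subspace Y"
    unfolding Y_def
  proof (rule subspaceI)
    show "0 \<in> T ` ?L" by (rule image_eqI[of _ _ "\<lambda>_. 0"]) (simp_all add: T_def)
    fix x y :: linf01 and c :: real
    assume "x \<in> T ` ?L"
    then obtain a where a: "a \<in> ?L" "x = T a" by (rule imageE)
    show "c *\<^sub>R x \<in> T ` ?L"
      unfolding a(2) scale[OF a(1), symmetric] by (rule imageI[OF scaleL[OF a(1)]])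
    assume "y \<in> T ` ?L"
    then obtain b where b: "b \<in> ?L" "y = T b" by (rule imageE)
    show "x + y \<in> T ` ?L"
      unfolding a(2) b(2) add[OF a(1) b(1), symmetric] by (rule imageI[OF addL[OF a(1) b(1)]])
  qed
  have "Y \<subseteq> lower_half"
  proof
    fix y assume "y \<in> Y"
    then obtain a where a: "a \<in> ?L" "y = T a" by (auto simp: Y_def)
    have "restr01 upper_half (T a) = (\<Sum>n. restr01 upper_half (a n *\<^sub>R rademacher01 n))"
      unfolding T_def by (rule bounded_linear.suminf[OF bounded_linear_restr01[OF upper_half_sets] s[OF a(1)]])
    also have "\<dots> = 0"
      by (simp add: linear_scale[OF bounded_linear.linear[OF bounded_linear_restr01[OF upper_half_sets]]]
          restr01_rademacher01)
    finally show "y \<in> lower_half" by (simp add: lower_half_def a)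
  qed
  moreover have "nspace_isomorphism ell1 (nspace_of Y) T"
    unfolding nspace_isomorphism_def
  proof (intro conjI)
    show "nspace_bounded_linear ell1 (nspace_of Y) T"
      unfolding nspace_bounded_linear_def car
    proof (intro conjI)
      show "\<exists>K. \<forall>x\<in>?L. nnorm (nspace_of Y) (T x) \<le> K * nnorm ell1 x"
        using upper by (intro exI[of _ 1]) (simp add: nspace_of_def ell1_def)
    qed (use add scale in \<open>auto simp: nspace_of_def ell1_def Y_def\<close>)
    show "bij_betw T (ncarrier ell1) (ncarrier (nspace_of Y))"
      unfolding car bij_betw_def using inj by (simp add: nspace_of_def Y_def)
    let ?S = "inv_into (ncarrier ell1) T"
    have S: "?S (T a) = a" if "a \<in> ?L" for a
      unfolding car by (rule inv_into_f_f[OF inj that])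
    have Sadd: "?S (T a + T b) = (\<lambda>n. a n + b n)" if "a \<in> ?L" "b \<in> ?L" for a b
      using S[OF addL[OF that]] by (simp add: add[OF that])
    have Sscale: "?S (c *\<^sub>R T a) = (\<lambda>n. c * a n)" if "a \<in> ?L" for a c
      using S[OF scaleL[OF that]] by (simp add: scale[OF that])
    show "nspace_bounded_linear (nspace_of Y) ell1 ?S"
      unfolding nspace_bounded_linear_def
    proof (intro conjI)
      show "\<exists>K. \<forall>x\<in>ncarrier (nspace_of Y). nnorm ell1 (?S x) \<le> K * nnorm (nspace_of Y) x"
        using lower S by (intro exI[of _ 1]) (auto simp: nspace_of_def Y_def ell1_def)
      show "\<forall>x\<in>ncarrier (nspace_of Y). ?S x \<in> ncarrier ell1"
        using S by (auto simp: nspace_of_def Y_def car)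
      show "\<forall>x\<in>ncarrier (nspace_of Y). \<forall>y\<in>ncarrier (nspace_of Y).
          ?S (nadd (nspace_of Y) x y) = nadd ell1 (?S x) (?S y)"
        using S Sadd by (simp add: nspace_of_def Y_def) (simp add: ell1_def)
      show "\<forall>c. \<forall>x\<in>ncarrier (nspace_of Y). ?S (nscale (nspace_of Y) c x) = nscale ell1 c (?S x)"
        using S Sscale by (simp add: nspace_of_def Y_def) (simp add: ell1_def)
    qed
  qed
  ultimately show ?thesis unfolding contains_ell1_def using Y by blast
qed

text \<open>
  If the closure of the image of the unit ball of \<open>Z\<close> contains a relatively open subset of the unit ball of
  the quotient, it contains a full ball around a point \<open>\<beta>\<close> obtained by moving the given centre slightly
  towards 0. The closure is convex and symmetric, so it also contains the ball of the same radius around 0.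
\<close>

lemma ball_image_somewhere_dense:
  fixes E Z :: "'a::real_normed_vector set"
  assumes E: "subspace E" "closed E" and Z: "subspace Z"
    and nd: "\<not> nowhere_dense_in (subtopology (ntopology (quot_space E)) (nball (quot_space E)))
          (quot_map E ` {z \<in> Z. norm z \<le> 1})"
  obtains \<delta> where "0 < \<delta>" "\<delta> \<le> 1"
    "\<And>h \<eta>. norm h \<le> \<delta> \<Longrightarrow> \<eta> > 0 \<Longrightarrow> \<exists>z\<in>Z. norm z \<le> 1 \<and> infdist (z - h) E < \<eta>"
proof -
  let ?X = "quot_space E" and ?S = "quot_map E ` {z \<in> Z. norm z \<le> 1}"
  let ?\<tau> = "subtopology (ntopology ?X) (nball ?X)"
  interpret X: normed_nspace ?X by (rule normed_nspace_quot[OF E])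
  interpret M: Metric_space "ncarrier ?X" "ndist ?X" by (rule X.Metric_space_ndist)
  have car: "ncarrier ?X = range (quot_map E)" by (simp add: quot_space_def)
  have carI: "quot_map E x \<in> ncarrier ?X" for x by (simp add: car)
  have dist: "ndist ?X (quot_map E x) (quot_map E y) = infdist (x - y) E" for x y
    by (simp add: ndist_def car quot_scale[OF E(1)] quot_add[OF E(1)] quot_norm[OF E(1)])
  have ball: "quot_map E x \<in> nball ?X \<longleftrightarrow> infdist x E \<le> 1" for x
    by (simp add: nball_def car quot_norm[OF E(1)])
  have tri: "infdist (x + y) E \<le> infdist x E + infdist y E" for x y
    using X.norm_triangle[of "quot_map E x" "quot_map E y"]
    by (simp add: car quot_add[OF E(1)] quot_norm[OF E(1)])
  have sc: "infdist (c *\<^sub>R x) E = \<bar>c\<bar> * infdist x E" for c x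
    using X.norm_scale[of "quot_map E x" c]
    by (simp add: car quot_scale[OF E(1)] quot_norm[OF E(1)])
  have le: "infdist x E \<le> norm x" for x
    using infdist_le[OF subspace_0[OF E(1)], of x] by simp
  have top: "topspace ?\<tau> = nball ?X"
    by (auto simp: ntopology_def nball_def)
  have "?S \<subseteq> topspace ?\<tau>"
    unfolding top using order_trans[OF le] by (auto simp: ball)
  then obtain A where A: "A \<in> ?\<tau> interior_of (?\<tau> closure_of ?S)"
    using nd unfolding nowhere_dense_in_def by blast
  then obtain U where U: "openin ?\<tau> U" "A \<in> U" "U \<subseteq> ?\<tau> closure_of ?S"
    unfolding interior_of_def by blast
  then obtain V where V: "openin (ntopology ?X) V" "U = V \<inter> nball ?X"
    by (auto simp: openin_subtopology)
  then obtain r where r: "r > 0" "M.mball A r \<subseteq> V"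
    using V(1) U(2) unfolding V(2) ntopology_def M.openin_mtopology by blast
  have approx: "\<exists>z\<in>Z. norm z \<le> 1 \<and> infdist (z - b) E < \<eta>"
    if b: "quot_map E b \<in> M.mball A r" "infdist b E \<le> 1" and \<eta>: "\<eta> > 0" for b \<eta>
  proof -
    have "quot_map E b \<in> ?\<tau> closure_of ?S"
    proof (rule subsetD[OF U(3)])
      show "quot_map E b \<in> U" unfolding V(2) using subsetD[OF r(2) b(1)] b(2) ball by simp
    qed
    then have meets: "\<exists>y. y \<in> ?S \<and> y \<in> T" if "quot_map E b \<in> T" "openin ?\<tau> T" for T
      using that unfolding in_closure_of by blast
    have "\<exists>y. y \<in> ?S \<and> y \<in> M.mball (quot_map E b) \<eta> \<inter> nball ?X"
    proof (rule meets)
      show "quot_map E b \<in> M.mball (quot_map E b) \<eta> \<inter> nball ?X"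
        using b(2) \<eta> ball carI by simp
      show "openin ?\<tau> (M.mball (quot_map E b) \<eta> \<inter> nball ?X)"
        unfolding ntopology_def by (intro openin_subtopology_Int M.openin_mball)
    qed
    then obtain z where z: "z \<in> Z" "norm z \<le> 1" "quot_map E z \<in> M.mball (quot_map E b) \<eta>"
      by (elim exE conjE imageE IntE) blast
    have "ndist ?X (quot_map E z) (quot_map E b) < \<eta>"
      using z(3) by (subst M.commute) simp
    with z show ?thesis unfolding dist by blast
  qed
  obtain \<alpha> where \<alpha>: "A = quot_map E \<alpha>" "infdist \<alpha> E \<le> 1"
    using U(2) V(2) car by (auto simp: nball_def quot_norm[OF E(1)])
  define \<delta> where "\<delta> = min 1 r / 3"
  have \<delta>: "0 < \<delta>" "\<delta> \<le> 1" "2 * \<delta> < r" using r(1) by (auto simp: \<delta>_def min_def)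
  show ?thesis
  proof (rule that[OF \<delta>(1,2)])
    fix h :: 'a and \<eta> :: real assume h: "norm h \<le> \<delta>" and \<eta>: "\<eta> > 0"
    define \<beta> where "\<beta> = (1 - \<delta>) *\<^sub>R \<alpha>"
    have near: "\<exists>z\<in>Z. norm z \<le> 1 \<and> infdist (z - (\<beta> + k)) E < \<eta>" if k: "norm k \<le> \<delta>" for k
    proof (rule approx[OF _ _ \<eta>])
      have "\<alpha> - (\<beta> + k) = \<delta> *\<^sub>R \<alpha> + (-1) *\<^sub>R k" by (simp add: \<beta>_def algebra_simps)
      then have "infdist (\<alpha> - (\<beta> + k)) E \<le> \<delta> * infdist \<alpha> E + infdist k E"
        using tri[of "\<delta> *\<^sub>R \<alpha>" "(-1) *\<^sub>R k"] \<delta>(1) by (simp only: sc)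
      also have "\<dots> \<le> \<delta> * 1 + \<delta>"
        using \<alpha>(2) \<delta>(1) k le[of k] by (intro add_mono mult_left_mono) auto
      finally show "quot_map E (\<beta> + k) \<in> M.mball A r"
        using \<delta>(3) by (simp add: \<alpha>(1) carI dist)
      have "infdist (\<beta> + k) E \<le> (1 - \<delta>) * infdist \<alpha> E + infdist k E"
        using tri[of \<beta> k] \<delta>(2) unfolding \<beta>_def by (simp only: sc)
      also have "\<dots> \<le> (1 - \<delta>) * 1 + \<delta>"
        using \<alpha>(2) \<delta> k le[of k] by (intro add_mono mult_left_mono) auto
      finally show "infdist (\<beta> + k) E \<le> 1" by simp
    qed
    obtain z1 z2 where z: "z1 \<in> Z" "norm z1 \<le> 1" "infdist (z1 - (\<beta> + h)) E < \<eta>"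
      "z2 \<in> Z" "norm z2 \<le> 1" "infdist (z2 - (\<beta> + - h)) E < \<eta>"
      using near[of h] near[of "- h"] h by auto
    define z where "z = (1/2) *\<^sub>R (z1 - z2)"
    have "norm z \<le> 1"
      using norm_triangle_ineq4[of z1 z2] z by (simp add: z_def)
    moreover have "z \<in> Z"
      unfolding z_def using z Z by (intro subspace_scale subspace_diff)
    moreover have "infdist (z - h) E < \<eta>"
    proof -
      have "z - h = (1/2) *\<^sub>R ((z1 - z2) - 2 *\<^sub>R h)"
        by (simp add: z_def scaleR_diff_right)
      also have "(z1 - z2) - 2 *\<^sub>R h = (z1 - (\<beta> + h)) + (-1) *\<^sub>R (z2 - (\<beta> + - h))"
        by (simp add: scaleR_2)
      finally have "z - h = (1/2) *\<^sub>R ((z1 - (\<beta> + h)) + (-1) *\<^sub>R (z2 - (\<beta> + - h)))" .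
      then show ?thesis
        using tri[of "z1 - (\<beta> + h)" "(-1) *\<^sub>R (z2 - (\<beta> + - h))"] z by (simp only: sc)
    qed
    ultimately show "\<exists>z\<in>Z. norm z \<le> 1 \<and> infdist (z - h) E < \<eta>" by blast
  qed
qed

text \<open>
  A poor \<open>Z\<close> whose unit ball has somewhere dense image modulo \<open>lower_half\<close> would approximate all small
  functions on the upper half, since the distance from \<open>lower_half\<close> bounds the norm of the restriction to the
  upper half.
\<close>

lemma bank_lower_half: "bank lower_half"
  unfolding bank_def
proof (intro conjI allI impI)
  fix Z :: "linf01 set" assume poor: "poor Z"
  show "nowhere_dense_in
      (subtopology (ntopology (quot_space lower_half)) (nball (quot_space lower_half)))
      (quot_map lower_half ` {z \<in> Z. norm z \<le> 1})"
  proof (rule ccontr)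
    assume nd: "\<not> ?thesis"
    have "subspace Z" using poor by (simp add: poor_def)
    then obtain \<delta> where \<delta>: "0 < \<delta>" "\<delta> \<le> 1" and dense:
      "\<And>h \<eta>. norm h \<le> \<delta> \<Longrightarrow> \<eta> > 0 \<Longrightarrow> \<exists>z\<in>Z. norm z \<le> 1 \<and> infdist (z - h) lower_half < \<eta>"
      using ball_image_somewhere_dense[OF subspace_lower_half closed_lower_half _ nd] by blast
    have "\<not> poor Z"
    proof (rule not_poor_if_restriction_dense[OF \<delta>])
      fix h :: linf01 and \<eta> :: real assume "norm h \<le> \<delta>" "\<eta> > 0"
      then show "\<exists>z\<in>Z. norm z \<le> 1 \<and> norm (restr01 upper_half (z - h)) \<le> \<eta>"
        using dense norm_restr_le_infdist by (meson less_imp_le order_trans)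
    qed
    then show False using poor by simp
  qed
qed (fact daugavet_linf01 subspace_lower_half closed_lower_half contains_ell1_lower_half)+

theorem theorem3p6:
  shows "(\<exists>E :: linf01 set. bank E) \<and>
    (\<forall>Z :: linf01 set.
       subspace Z \<and> closed Z \<and> separable_space (top_of_set Z) \<longrightarrow> poor Z)"
  using bank_lower_half separable_imp_poor by blast

end
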